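(* Let $(T,\mathcal B,\mu)$ be a finite measure space, $d,n\in\mathbb N$, and let $p,r\in[1,+\infty)$ with $r\ge p$, such that $L^p_{\mathbb R^d}(\mu)$ is separable. Let $X=(X_t)_{t\in T}$ be a bi-measurable $\mathbb R^d$-valued process on a probability space $(\Omega,\mathcal A,\mathbb P)$ satisfying $$\mathbb E\Big(\int_T|X_t|_p^p\,d\mu(t)\Big)^{r/p}<+\infty\qquad\text{and}\qquad\forall\,t\in T,\ X_t\in L^{r-1}_{\mathbb R^d}(\mathbb P).$$ Let $\alpha=\{a_1,\dots,a_n\}\subset L^p_{\mathbb R^d}(\mu)$ be an $(L^r,\|\cdot\|_p)$-stationary $n$-quantizer for $X$. Set $I_r(\alpha):=\{i\in\{1,\dots,n\}:\mathbb P(X=a_i)=0\}$ if $r>p$ and $I_r(\alpha):=\{1,\dots,n\}$ otherwise. (a) Let $T$ be a compact metric space and let $\mu$ be a continuous finite Borel measure on $T$. If $p=1$, if $X$ is pathwise continuous with $$\mathrm{supp}(\mathbb P_X)=\{f\in C_{\mathbb R^d}(T):f(t)=x,\ t\in T_0\}$$ (where $X$ is viewed as a $(C_{\mathbb R^d}(T),\|\cdot\|_{\sup})$-valued random vector) for some $x\in\mathbb R^d$ and some closed subset $T_0$ of $T$ with $\mu(T_0)=0$, and if the distribution $\mathbb P_{X_{j,t}}$ is continuous on $\mathbb R$ for every $t\in T\setminus T_0$ and $j\in\{1,\dots,d\}$, then the components of $\alpha$ have $\mu$-versions consisting of continuous functions such that $a_i(t)=x$ for $t\in T_0$, $i=1,\dots,n$.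 (b) If $p\in(1,\infty)$, then the components $a_i$, $i\in I_r(\alpha)$, of $\alpha$ have $\mu$-versions consisting of $\rho_X^{r-1}$-continuous functions. Furthermore, if $X_t=x\in\mathbb R^d$ for $t\in T_0\subset T$, then there are such versions with $a_i(t)=x$ for $t\in T_0$. (c) If $p=2$, then the components $a_i$, $i\in I_r(\alpha)$, of $\alpha$ have $\mu$-versions consisting of $\rho_X^{r-1}$-Lipschitz continuous functions.
   Context: Write $X_t=(X_{1,t},\dots,X_{d,t})$ and $X_j=(X_{j,t})_{t\in T}$. For $q>0$, $|x|_q=(\sum_{i=1}^d|x_i|^q)^{1/q}$ on $\mathbb R^d$, and $X_t\in L^q_{\mathbb R^d}(\mathbb P)$ means $\mathbb E|X_t|_q^q<\infty$ ($q=0$: no integrability condition). A process is bi-measurable if $(\omega,t)\mapsto X_t(\omega)$ is $\mathcal A\otimes\mathcal B$-measurable. $L^p_{\mathbb R^d}(\mu)$ carries the norm $\|f\|_p=(\int_T|f(t)|_p^p\,d\mu(t))^{1/p}$, and $X$ is viewed as an $L^p_{\mathbb R^d}(\mu)$-valued random vector with distribution $\mathbb P_X$. A measure (distribution) is continuous if it has no atoms (gives mass zero to points). $C_{\mathbb R^d}(T)$ is the space of continuous functions $T\to\mathbb R^d$ and $\|f\|_{\sup}=\sup_{t}|f(t)|_\infty$, with $|\cdot|_\infty$ the $\ell^\infty$-norm on $\mathbb R^d$. For $q\in(0,\infty)$, if $X_t\in L^q_{\mathbb R^d}(\mathbb P)$ for every $t\in T$, the intrinsic semimetric $\rho_X^q$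 on $T$ is $\rho_X^q(s,t):=(\mathbb E|X_s-X_t|_q^q)^{1/(q\vee1)}$. Voronoi partition: for $\alpha=\{a_1,\dots,a_n\}\subset L^p_{\mathbb R^d}(\mu)$, a Voronoi partition induced by $\alpha$ is a Borel partition $\{C_i(\alpha):1\le i\le n\}$ of $L^p_{\mathbb R^d}(\mu)$ with $C_i(\alpha)\subset\{f:\|f-a_i\|_p=\min_{1\le k\le n}\|f-a_k\|_p\}$ for every $i$. Stationarity: $\alpha=\{a_1,\dots,a_n\}$ (of cardinality $n$, with $a_i=(a_{i1},\dots,a_{id})$) is $(L^r,\|\cdot\|_p)$-stationary for $X$ if, for any Voronoi partition $\{C_i(\alpha)\}$ induced by $\alpha$, $\mathbb P_X(C_i(\alpha))>0$ for every $i$ and, for all $i=1,\dots,n$, $j=1,\dots,d$, $$\mathbb E\Big(\mathbf 1_{C_i(\alpha)}(X)\,\|X-a_i\|_p^{r-p}\,|a_{ij}-X_j|^{p-1}\,\mathrm{sign}(a_{ij}-X_j)\Big)=0$$ as an element of $L^q(\mu)$, $\frac1p+\frac1q=1$ (i.e. evaluated at $t$, for $\mu$-a.e. $t\in T$), with the convention $0/\|0\|=0$ and $\mathrm{sign}(0)=0$. *)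

theory Defs
  imports "HOL-Probability.Probability"
begin

section \<open>The space of $p$-integrable vector-valued functions\<close>

text \<open>
  The index type \<open>'d\<close> plays the role of $\{1,\dots,d\}$. Note that \<open>0 powr s = 0\<close> for
  every \<open>s\<close>, including \<open>s = 0\<close>.
\<close>

definition ell_norm :: "real \<Rightarrow> real ^ 'd \<Rightarrow> real" where
  "ell_norm q x = (\<Sum>i\<in>UNIV. \<bar>x $ i\<bar> powr q) powr (1 / q)"

text \<open>
  Elements of $L^p_{\mathbb R^d}(\mu)$ are represented by functions, and \<open>Lp_norm\<close> is a
  seminorm on them. All open, and hence all Borel, sets of the seminormed space are saturated
  with respect to almost everywhere equality, so they correspond exactly to the open and Borel
  sets of the quotient space. Equality in the quotient is \<open>AE t in M. f t = g t\<close>.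
\<close>

definition Lp_space :: "'t measure \<Rightarrow> real \<Rightarrow> ('t \<Rightarrow> real ^ 'd) set" where
  "Lp_space M p =
     {f \<in> borel_measurable M. integrable M (\<lambda>t. ell_norm p (f t) powr p)}"

definition Lp_norm :: "'t measure \<Rightarrow> real \<Rightarrow> ('t \<Rightarrow> real ^ 'd) \<Rightarrow> real" where
  "Lp_norm M p f = (LINT t|M. ell_norm p (f t) powr p) powr (1 / p)"

definition Lp_separable :: "'t measure \<Rightarrow> real \<Rightarrow> 'd::finite itself \<Rightarrow> bool" where
  "Lp_separable M p _ \<longleftrightarrow>
     (\<exists>D \<subseteq> (Lp_space M p :: ('t \<Rightarrow> real ^ 'd) set). countable D \<and>
        (\<forall>f \<in> Lp_space M p. \<forall>\<epsilon>>0. \<exists>g\<in>D. Lp_norm M p (\<lambda>t. f t - g t) < \<epsilon>))"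

definition Lp_open :: "'t measure \<Rightarrow> real \<Rightarrow> ('t \<Rightarrow> real ^ 'd) set \<Rightarrow> bool" where
  "Lp_open M p U \<longleftrightarrow> U \<subseteq> Lp_space M p \<and>
     (\<forall>f\<in>U. \<exists>\<epsilon>>0. \<forall>g \<in> Lp_space M p. Lp_norm M p (\<lambda>t. g t - f t) < \<epsilon> \<longrightarrow> g \<in> U)"

definition Lp_borel :: "'t measure \<Rightarrow> real \<Rightarrow> ('t \<Rightarrow> real ^ 'd) measure" where
  "Lp_borel M p = sigma (Lp_space M p) {U. Lp_open M p U}"

definition Lp_version ::
    "'t measure \<Rightarrow> real \<Rightarrow> ('t \<Rightarrow> real ^ 'd) \<Rightarrow> ('t \<Rightarrow> real ^ 'd) \<Rightarrow> bool" where
  "Lp_version M p f b \<longleftrightarrow> b \<in> Lp_space M p \<and> (AE t in M. b t = f t)"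


section \<open>Processes\<close>

definition bimeasurable ::
    "'w measure \<Rightarrow> 't measure \<Rightarrow> ('t \<Rightarrow> 'w \<Rightarrow> real ^ 'd) \<Rightarrow> bool" where
  "bimeasurable P M X \<longleftrightarrow> (\<lambda>(\<omega>, t). X t \<omega>) \<in> borel_measurable (P \<Otimes>\<^sub>M M)"

definition Lq_random_vector :: "'w measure \<Rightarrow> real \<Rightarrow> ('w \<Rightarrow> real ^ 'd) \<Rightarrow> bool" where
  "Lq_random_vector P q Y \<longleftrightarrow> Y \<in> borel_measurable P \<and>
     (q > 0 \<longrightarrow> integrable P (\<lambda>\<omega>. ell_norm q (Y \<omega>) powr q))"

definition epowr :: "ennreal \<Rightarrow> real \<Rightarrow> ennreal" where
  "epowr y s = (if y = \<infinity> then \<infinity> else ennreal (enn2real y powr s))"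

text \<open>
  $\mathbb E\left(\int_T |X_t|_p^p\,d\mu(t)\right)^{r/p} < \infty$ (with $r > 0$). It entails that
  almost every path lies in \<open>Lp_space M p\<close>.
\<close>

definition finite_path_moment ::
    "'w measure \<Rightarrow> 't measure \<Rightarrow> real \<Rightarrow> real \<Rightarrow> ('t \<Rightarrow> 'w \<Rightarrow> real ^ 'd) \<Rightarrow> bool" where
  "finite_path_moment P M p r X \<longleftrightarrow>
     (\<integral>\<^sup>+\<omega>. epowr (\<integral>\<^sup>+t. ennreal (ell_norm p (X t \<omega>) powr p) \<partial>M) (r / p) \<partial>P) < \<infinity>"

definition intrinsic_semimetric ::
    "'w measure \<Rightarrow> ('t \<Rightarrow> 'w \<Rightarrow> real ^ 'd) \<Rightarrow> real \<Rightarrow> 't \<Rightarrow> 't \<Rightarrow> real" where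
  "intrinsic_semimetric P X q s t =
     (LINT \<omega>|P. ell_norm q (X s \<omega> - X t \<omega>) powr q) powr (1 / max q 1)"

definition semimetric_continuous_on ::
    "'t set \<Rightarrow> ('t \<Rightarrow> 't \<Rightarrow> real) \<Rightarrow> ('t \<Rightarrow> real ^ 'd) \<Rightarrow> bool" where
  "semimetric_continuous_on T \<rho> f \<longleftrightarrow>
     (\<forall>s\<in>T. \<forall>\<epsilon>>0. \<exists>\<delta>>0. \<forall>t\<in>T. \<rho> s t < \<delta> \<longrightarrow> norm (f s - f t) < \<epsilon>)"

definition semimetric_lipschitz_on ::
    "'t set \<Rightarrow> ('t \<Rightarrow> 't \<Rightarrow> real) \<Rightarrow> ('t \<Rightarrow> real ^ 'd) \<Rightarrow> bool" where
  "semimetric_lipschitz_on T \<rho> f \<longleftrightarrow>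
     (\<exists>L\<ge>0. \<forall>s\<in>T. \<forall>t\<in>T. norm (f s - f t) \<le> L * \<rho> s t)"


section \<open>Quantizers, Voronoi partitions and stationarity\<close>

definition quantizer ::
    "'t measure \<Rightarrow> real \<Rightarrow> nat \<Rightarrow> (nat \<Rightarrow> 't \<Rightarrow> real ^ 'd) \<Rightarrow> bool" where
  "quantizer M p n a \<longleftrightarrow> (\<forall>i\<in>{1..n}. a i \<in> Lp_space M p) \<and>
     (\<forall>i\<in>{1..n}. \<forall>k\<in>{1..n}. i \<noteq> k \<longrightarrow> \<not> (AE t in M. a i t = a k t))"

definition voronoi_partition ::
    "'t measure \<Rightarrow> real \<Rightarrow> nat \<Rightarrow> (nat \<Rightarrow> 't \<Rightarrow> real ^ 'd) \<Rightarrow>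
       (nat \<Rightarrow> ('t \<Rightarrow> real ^ 'd) set) \<Rightarrow> bool" where
  "voronoi_partition M p n a C \<longleftrightarrow>
     (\<forall>i\<in>{1..n}. C i \<in> sets (Lp_borel M p)) \<and>
     disjoint_family_on C {1..n} \<and> (\<Union>i\<in>{1..n}. C i) = Lp_space M p \<and>
     (\<forall>i\<in>{1..n}. C i \<subseteq> {f. Lp_norm M p (\<lambda>t. f t - a i t) =
                            (MIN k\<in>{1..n}. Lp_norm M p (\<lambda>t. f t - a k t))})"

text \<open>
  The weight $\|X - a_i\|_p^{r-p}$ is $1$ for $r = p$. For $r < p$ and $\|X - a_i\|_p = 0$ it is
  \<open>0\<close> by the convention for \<open>powr\<close>, which yields the usual reading $0/\|0\| = 0$.
  The statement that the expectation is zero includes its existence.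
\<close>

definition stationary_quantizer ::
    "'w measure \<Rightarrow> 't measure \<Rightarrow> real \<Rightarrow> real \<Rightarrow> ('t \<Rightarrow> 'w \<Rightarrow> real ^ 'd) \<Rightarrow>
       nat \<Rightarrow> (nat \<Rightarrow> 't \<Rightarrow> real ^ 'd) \<Rightarrow> bool" where
  "stationary_quantizer P M p r X n a \<longleftrightarrow> quantizer M p n a \<and>
     (\<forall>C. voronoi_partition M p n a C \<longrightarrow>
       (\<forall>i\<in>{1..n}.
          \<P>(\<omega> in P. (\<lambda>t. X t \<omega>) \<in> C i) > 0 \<and>
          (\<forall>j. AE t in M. has_bochner_integral P
             (\<lambda>\<omega>. indicator (C i) (\<lambda>s. X s \<omega>) *
                  (if r = p then 1 else Lp_norm M p (\<lambda>s. X s \<omega> - a i s) powr (r - p)) *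
                  \<bar>a i t $ j - X t \<omega> $ j\<bar> powr (p - 1) * sgn (a i t $ j - X t \<omega> $ j))
             0)))"

definition index_set ::
    "'w measure \<Rightarrow> 't measure \<Rightarrow> real \<Rightarrow> real \<Rightarrow> ('t \<Rightarrow> 'w \<Rightarrow> real ^ 'd) \<Rightarrow>
       nat \<Rightarrow> (nat \<Rightarrow> 't \<Rightarrow> real ^ 'd) \<Rightarrow> nat set" where
  "index_set P M p r X n a =
     (if r > p then {i\<in>{1..n}. \<P>(\<omega> in P. AE t in M. X t \<omega> = a i t) = 0} else {1..n})"


section \<open>Continuous paths on a compact metric space\<close>

text \<open>Intended for measures whose singletons are measurable.\<close>

definition continuous_measure :: "'a measure \<Rightarrow> bool" where
  "continuous_measure N \<longleftrightarrow> (\<forall>x\<in>space N. emeasure N {x} = 0)"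

definition compact_metric_borel :: "'t metric \<Rightarrow> 't measure \<Rightarrow> bool" where
  "compact_metric_borel m M \<longleftrightarrow> mspace m = space M \<and> compact_space (mtopology_of m) \<and>
     sets M = sigma_sets (mspace m) {U. openin (mtopology_of m) U}"

text \<open>
  The values of a function outside \<open>mspace m\<close> are irrelevant in the next three definitions.
\<close>

definition continuous_functions :: "'t metric \<Rightarrow> ('t \<Rightarrow> real ^ 'd) set" where
  "continuous_functions m = {f. continuous_map (mtopology_of m) euclidean f}"

definition sup_norm :: "'t metric \<Rightarrow> ('t \<Rightarrow> real ^ 'd) \<Rightarrow> real" where
  "sup_norm m f = (SUP t\<in>mspace m. infnorm (f t))"

definition path_support ::
    "'w measure \<Rightarrow> 't metric \<Rightarrow> ('t \<Rightarrow> 'w \<Rightarrow> real ^ 'd) \<Rightarrow> ('t \<Rightarrow> real ^ 'd) set" where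
  "path_support P m X = {f \<in> continuous_functions m.
     \<forall>\<epsilon>>0. \<P>(\<omega> in P. sup_norm m (\<lambda>t. X t \<omega> - f t) < \<epsilon>) > 0}"

end

theory Submission
  imports Defs
begin

text \<open>
  Fix a cell with centre \<open>a i\<close> and let \<open>W\<close> be its random weight, the indicator that the path lies in
  the cell times the power \<open>r - p\<close> of the distance of the path to \<open>a i\<close>. Stationarity says that, for
  almost every \<open>t\<close>, each coordinate of \<open>a i t\<close> is a root \<open>y\<close> of
  \<open>E (W * \<bar>y - X t\<bar> powr (p - 1) * sgn (y - X t)) = 0\<close>, where \<open>X t\<close> stands for that coordinate of the
  process. The left side, called \<open>balance\<close> below, is
  defined for every \<open>t\<close> and increases in \<open>y\<close>. Once it increases strictly, it changes sign at exactly
  one point \<open>b t\<close>. The function \<open>b\<close> is measurable and agrees with \<open>a i\<close> almost everywhere, and its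
  regularity is that of \<open>t \<mapsto> balance t y\<close> for fixed \<open>y\<close>: values of the balance slightly to the
  left and right of \<open>b s\<close> keep their signs for \<open>t\<close> near \<open>s\<close> and trap \<open>b t\<close>
  (\<open>sign_change_tendsto\<close>). If \<open>X t\<close> is almost surely equal to a constant, then \<open>b t\<close> is that
  constant.

  For \<open>p > 1\<close> the signed power is strictly increasing, so the balance is too as soon as \<open>W\<close> is not
  almost surely \<open>0\<close>, which is what membership in the index set ensures. Continuity in \<open>t\<close> with
  respect to the intrinsic semimetric follows from the modulus of continuity
  \<open>signed_powr_diff_le\<close> and from an inequality of Young type for the weight (\<open>balance_continuous\<close>).
  For \<open>p = 2\<close> the balance is affine and \<open>b t = E (W * X t) / E W\<close>, from which Lipschitz
  continuity can be read off.

  For \<open>p = 1\<close> the balance is a weighted distribution function up to an affine map. It increases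
  strictly for \<open>t\<close> outside of \<open>T0\<close> if the paths in the cell reach every interval at time \<open>t\<close> with
  positive probability. They do (\<open>cell_charges_intervals\<close>): a Voronoi partition can be chosen in which
  the cell is open for the integral norm, and since points have measure \<open>0\<close>, a continuous path in
  the cell can be bent near \<open>t\<close> to pass through any value, and near \<open>T0\<close> to belong to the support,
  without leaving the cell. On \<open>T0\<close> the process is almost surely constant, because separability of
  the space of continuous functions makes almost every path belong to the support. Continuity of
  the balance along convergent sequences is dominated convergence, as the marginals have no atoms.
\<close>

section \<open>The seminormed space of \<open>p\<close>-integrable functions\<close>

lemma ell_norm_powr:
  assumes "p > 0"
  shows "ell_norm p x powr p = (\<Sum>i\<in>UNIV. \<bar>x $ i\<bar> powr p)"
  using assms by (simp add: ell_norm_def powr_powr sum_nonneg)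

definition Lp_energy :: "'t measure \<Rightarrow> real \<Rightarrow> ('t \<Rightarrow> real ^ 'd) \<Rightarrow> real" where
  "Lp_energy M p f = (LINT t|M. (\<Sum>i\<in>UNIV. \<bar>f t $ i\<bar> powr p))"

lemma Lp_energy_nonneg: "Lp_energy M p f \<ge> 0"
  unfolding Lp_energy_def by (intro integral_nonneg_AE) (auto simp: sum_nonneg)

lemma Lp_norm_eq_energy: "p > 0 \<Longrightarrow> Lp_norm M p f = Lp_energy M p f powr (1 / p)"
  by (simp add: Lp_norm_def Lp_energy_def ell_norm_powr)

lemma Lp_norm_nonneg: "Lp_norm M p f \<ge> 0"
  by (simp add: Lp_norm_def)

lemma Lp_norm_powr: "p > 0 \<Longrightarrow> Lp_norm M p f powr p = Lp_energy M p f"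
  by (simp add: Lp_norm_eq_energy powr_powr Lp_energy_nonneg)

lemma Lp_norm_le_iff:
  assumes "p > 0" "c \<ge> 0"
  shows "Lp_norm M p f \<le> c \<longleftrightarrow> Lp_energy M p f \<le> c powr p"
proof
  assume "Lp_norm M p f \<le> c"
  then have "Lp_norm M p f powr p \<le> c powr p"
    using assms by (intro powr_mono2) (auto simp: Lp_norm_nonneg)
  then show "Lp_energy M p f \<le> c powr p" using assms by (simp add: Lp_norm_powr)
next
  assume "Lp_energy M p f \<le> c powr p"
  then have "Lp_energy M p f powr (1 / p) \<le> (c powr p) powr (1 / p)"
    using assms by (intro powr_mono2) (auto simp: Lp_energy_nonneg)
  then show "Lp_norm M p f \<le> c" using assms by (simp add: Lp_norm_eq_energy powr_powr)
qed

lemma Lp_space_iff: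
  "p > 0 \<Longrightarrow> f \<in> Lp_space M p \<longleftrightarrow>
     f \<in> borel_measurable M \<and> integrable M (\<lambda>t. \<Sum>i\<in>UNIV. \<bar>f t $ i\<bar> powr p)"
  by (simp add: Lp_space_def ell_norm_powr)

text \<open>Away from \<open>0\<close> this is convexity of the power; if one of the points is \<open>0\<close>, it reduces to
  \<open>c powr p \<le> c\<close> for \<open>0 \<le> c \<le> 1\<close>.\<close>

lemma powr_convex_combination:
  fixes u v :: real
  assumes p: "1 \<le> p" and "0 \<le> la" "la \<le> 1" "0 \<le> u" "0 \<le> v"
  shows "(la * u + (1 - la) * v) powr p \<le> la * u powr p + (1 - la) * v powr p"
proof -
  have zero: "(c * w) powr p \<le> c * w powr p" if "0 \<le> c" "c \<le> 1" "0 \<le> w" for c w :: real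
  proof -
    have "c powr p \<le> c powr 1" if "c > 0"
      using that \<open>c \<le> 1\<close> p by (intro powr_mono') auto
    then have "c powr p \<le> c" using \<open>0 \<le> c\<close> by (cases "c = 0") auto
    then show ?thesis using that by (simp add: powr_mult mult_right_mono)
  qed
  show ?thesis
  proof (cases "u = 0 \<or> v = 0")
    case True
    then show ?thesis
      using zero[of la u] zero[of "1 - la" v] assms by auto
  next
    case False
    have "convex_on {0<..} (\<lambda>x::real. x powr p)" using powr_convex[OF p] .
    then have "((1 - (1-la)) *\<^sub>R u + (1-la) *\<^sub>R v) powr p \<le> (1 - (1-la)) * u powr p + (1-la) * v powr p"
      by (rule convex_onD) (use assms False in auto)
    then show ?thesis by simp
  qed
qed

text \<open>Convexity at the points \<open>\<bar>u\<bar> / A\<close> and \<open>\<bar>v\<bar> / B\<close> with weights proportional to \<open>A\<close> and \<open>B\<close>, scaled by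
  \<open>A + B\<close>. With \<open>A\<close> and \<open>B\<close> the norms of two functions, integration gives the triangle inequality.\<close>

lemma powr_add_le_weighted:
  fixes u v A B :: real
  assumes p: "1 \<le> p" and "A > 0" "B > 0"
  shows "\<bar>u + v\<bar> powr p \<le>
    (A + B) powr p * (A / (A + B) * (\<bar>u\<bar> powr p / A powr p) + B / (A + B) * (\<bar>v\<bar> powr p / B powr p))"
proof -
  define la where "la = A / (A + B)"
  have l: "0 \<le> la" "la \<le> 1" "1 - la = B / (A + B)" using assms by (auto simp: la_def field_simps)
  have s: "(A + B) * (la * (\<bar>u\<bar> / A) + (1 - la) * (\<bar>v\<bar> / B)) = \<bar>u\<bar> + \<bar>v\<bar>"
  proof -
    have "A + B \<noteq> 0" using assms by simp
    moreover have "(1 - la) = B / (A + B)" by (rule l(3))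
    moreover have "la = A / (A + B)" by (rule la_def)
    ultimately show ?thesis using assms by (simp add: distrib_left)
  qed
  have "\<bar>u + v\<bar> powr p \<le> (\<bar>u\<bar> + \<bar>v\<bar>) powr p" using p by (intro powr_mono2) auto
  also have "\<dots> = (A + B) powr p * (la * (\<bar>u\<bar> / A) + (1 - la) * (\<bar>v\<bar> / B)) powr p"
    unfolding s[symmetric] using assms l(1,2) by (subst powr_mult) auto
  also have "\<dots> \<le> (A + B) powr p * (la * (\<bar>u\<bar> / A) powr p + (1 - la) * (\<bar>v\<bar> / B) powr p)"
    using assms l by (intro mult_left_mono powr_convex_combination) auto
  finally show ?thesis using assms unfolding l(3) unfolding la_def by (simp add: powr_divide)
qed

lemma component_measurable [measurable (raw)]:
  fixes f :: "'a \<Rightarrow> real ^ 'd"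
  shows "f \<in> borel_measurable M \<Longrightarrow> (\<lambda>t. f t $ i) \<in> borel_measurable M"
  by (rule measurable_compose[OF _ borel_measurable_continuous_onI]) (auto intro: continuous_intros)

lemma Lp_space_add:
  assumes p: "1 \<le> p" and f: "f \<in> Lp_space M p" and g: "g \<in> Lp_space M p"
  shows "(\<lambda>t. f t + g t) \<in> Lp_space M p"
proof -
  have p0: "p > 0" using p by simp
  have [measurable]: "f \<in> borel_measurable M" "g \<in> borel_measurable M"
    using f g by (auto simp: Lp_space_def)
  have "integrable M (\<lambda>t. \<Sum>i\<in>UNIV. \<bar>(f t + g t) $ i\<bar> powr p)"
  proof (rule Bochner_Integration.integrable_bound)
    show "integrable M (\<lambda>t. 2 powr p *
      ((\<Sum>i\<in>UNIV. \<bar>f t $ i\<bar> powr p) + (\<Sum>i\<in>UNIV. \<bar>g t $ i\<bar> powr p)))"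
      using f g p0 by (auto simp: Lp_space_iff)
    have "\<bar>u + v\<bar> powr p \<le> 2 powr p * (\<bar>u\<bar> powr p + \<bar>v\<bar> powr p)" for u v :: real
    proof -
      have "\<bar>u + v\<bar> powr p \<le> 2 powr p * ((\<bar>u\<bar> powr p + \<bar>v\<bar> powr p) / 2)"
        using powr_add_le_weighted[OF p, of 1 1 u v] by (simp add: field_simps)
      also have "\<dots> \<le> 2 powr p * (\<bar>u\<bar> powr p + \<bar>v\<bar> powr p)"
        by (intro mult_left_mono) auto
      finally show ?thesis .
    qed
    then show "AE t in M. norm (\<Sum>i\<in>UNIV. \<bar>(f t + g t) $ i\<bar> powr p)
      \<le> norm (2 powr p * ((\<Sum>i\<in>UNIV. \<bar>f t $ i\<bar> powr p) + (\<Sum>i\<in>UNIV. \<bar>g t $ i\<bar> powr p)))"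
      by (auto simp: sum_nonneg sum.distrib[symmetric] sum_distrib_left intro!: sum_mono)
  qed measurable
  then show ?thesis using p0 by (simp add: Lp_space_iff)
qed

text \<open>Minkowski's inequality: integrate the previous pointwise bound, where \<open>A\<close> and \<open>B\<close> are the two
  norms, increased by half of the allowed error so that neither vanishes.\<close>

lemma Lp_norm_triangle:
  assumes p: "1 \<le> p" and f: "f \<in> Lp_space M p" and g: "g \<in> Lp_space M p"
  shows "Lp_norm M p (\<lambda>t. f t + g t) \<le> Lp_norm M p f + Lp_norm M p g"
proof (rule field_le_epsilon)
  fix e :: real assume e: "e > 0"
  have p0: "p > 0" using p by simp
  define A where "A = Lp_norm M p f + e / 2"
  define B where "B = Lp_norm M p g + e / 2"
  have AB: "A > 0" "B > 0" using e by (auto simp: A_def B_def add_nonneg_pos Lp_norm_nonneg)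
  have fg: "(\<lambda>t. f t + g t) \<in> Lp_space M p" using Lp_space_add[OF p f g] .
  have EA: "Lp_energy M p f \<le> A powr p"
    using Lp_norm_le_iff[OF p0, of A M f] AB e by (auto simp: A_def)
  have EB: "Lp_energy M p g \<le> B powr p"
    using Lp_norm_le_iff[OF p0, of B M g] AB e by (auto simp: B_def)
  have if': "integrable M (\<lambda>t. \<Sum>i\<in>UNIV. \<bar>f t $ i\<bar> powr p)"
    and ig': "integrable M (\<lambda>t. \<Sum>i\<in>UNIV. \<bar>g t $ i\<bar> powr p)"
    using f g p0 by (auto simp: Lp_space_iff)
  have "Lp_energy M p (\<lambda>t. f t + g t) \<le>
    (LINT t|M. (A + B) powr p * (A / (A + B) * ((\<Sum>i\<in>UNIV. \<bar>f t $ i\<bar> powr p) / A powr p)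
                        + B / (A + B) * ((\<Sum>i\<in>UNIV. \<bar>g t $ i\<bar> powr p) / B powr p)))"
    unfolding Lp_energy_def
  proof (rule integral_mono)
    show "integrable M (\<lambda>t. \<Sum>i\<in>UNIV. \<bar>(f t + g t) $ i\<bar> powr p)"
      using fg p0 by (simp add: Lp_space_iff)
    fix t
    have "(\<Sum>i\<in>UNIV. \<bar>(f t + g t) $ i\<bar> powr p) \<le> (\<Sum>i\<in>UNIV. 
      (A + B) powr p * (A / (A + B) * (\<bar>f t $ i\<bar> powr p / A powr p) + B / (A + B) * (\<bar>g t $ i\<bar> powr p / B powr p)))"
      by (intro sum_mono) (simp only: vector_add_component, rule powr_add_le_weighted[OF p AB])
    also have "\<dots> = (A + B) powr p * (A / (A + B) * ((\<Sum>i\<in>UNIV. \<bar>f t $ i\<bar> powr p) / A powr p)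
                        + B / (A + B) * ((\<Sum>i\<in>UNIV. \<bar>g t $ i\<bar> powr p) / B powr p))"
      by (simp only: sum_distrib_left[symmetric] sum.distrib sum_divide_distrib[symmetric])
    finally show "(\<Sum>i\<in>UNIV. \<bar>(f t + g t) $ i\<bar> powr p) \<le> \<dots>" .
  qed (use if' ig' in auto)
  also have "\<dots> = (A + B) powr p * (A / (A + B) * (Lp_energy M p f / A powr p)
                        + B / (A + B) * (Lp_energy M p g / B powr p))"
    using if' ig' by (simp add: Lp_energy_def)
  also have "\<dots> \<le> (A + B) powr p * (A / (A + B) * 1 + B / (A + B) * 1)"
    using EA EB AB by (intro mult_left_mono add_mono) (auto simp: divide_le_eq)
  also have "\<dots> = (A + B) powr p" using AB by (simp add: add_divide_distrib[symmetric])
  finally have "Lp_norm M p (\<lambda>t. f t + g t) \<le> A + B"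
    using Lp_norm_le_iff[OF p0, of "A + B" M "\<lambda>t. f t + g t"] AB by simp
  then show "Lp_norm M p (\<lambda>t. f t + g t) \<le> Lp_norm M p f + Lp_norm M p g + e"
    by (simp add: A_def B_def)
qed

lemma Lp_space_minus: "p > 0 \<Longrightarrow> f \<in> Lp_space M p \<Longrightarrow> (\<lambda>t. - f t) \<in> Lp_space M p"
  by (auto simp: Lp_space_iff)

lemma Lp_norm_minus: "Lp_norm M p (\<lambda>t. - f t) = Lp_norm M p f"
  by (simp add: Lp_norm_def ell_norm_def)

lemma Lp_space_diff:
  assumes "1 \<le> p" "f \<in> Lp_space M p" "g \<in> Lp_space M p"
  shows "(\<lambda>t. f t - g t) \<in> Lp_space M p"
  using Lp_space_add[OF assms(1,2) Lp_space_minus[OF _ assms(3)]] assms(1) by simp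

lemma Lp_norm_dist_triangle:
  assumes p: "1 \<le> p" and "f \<in> Lp_space M p" "g \<in> Lp_space M p" "h \<in> Lp_space M p"
  shows "Lp_norm M p (\<lambda>t. f t - h t) \<le> Lp_norm M p (\<lambda>t. f t - g t) + Lp_norm M p (\<lambda>t. g t - h t)"
  using Lp_norm_triangle[OF p Lp_space_diff[OF p assms(2,3)] Lp_space_diff[OF p assms(3,4)]] by simp

lemma Lp_norm_dist_commute: "Lp_norm M p (\<lambda>t. f t - g t) = Lp_norm M p (\<lambda>t. g t - f t)"
  using Lp_norm_minus[of M p "\<lambda>t. f t - g t"] by simp

lemma Lp_norm_eq_0_iff:
  assumes "p > 0" and f: "f \<in> Lp_space M p"
  shows "Lp_norm M p f = 0 \<longleftrightarrow> (AE t in M. f t = 0)"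
proof -
  have "Lp_norm M p f = 0 \<longleftrightarrow> Lp_energy M p f = 0" using assms(1) by (simp add: Lp_norm_eq_energy)
  also have "\<dots> \<longleftrightarrow> (AE t in M. (\<Sum>i\<in>UNIV. \<bar>f t $ i\<bar> powr p) = 0)"
    unfolding Lp_energy_def using f assms(1)
    by (intro integral_nonneg_eq_0_iff_AE) (auto simp: Lp_space_iff sum_nonneg)
  also have "\<dots> \<longleftrightarrow> (AE t in M. f t = 0)"
    by (simp add: sum_nonneg_eq_0_iff vec_eq_iff)
  finally show ?thesis .
qed

lemma space_Lp_borel: "space (Lp_borel M p) = Lp_space M p"
  unfolding Lp_borel_def by (subst space_measure_of) (auto simp: Lp_open_def)

lemma Lp_open_in_sets: "Lp_open M p U \<Longrightarrow> U \<in> sets (Lp_borel M p)"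
  unfolding Lp_borel_def by (subst sets_measure_of) (auto simp: Lp_open_def)

lemma Lp_dist_less_open:
  assumes p: "1 \<le> p" and a: "a \<in> Lp_space M p"
  shows "Lp_open M p {f \<in> Lp_space M p. Lp_norm M p (\<lambda>t. f t - a t) < c}"
  unfolding Lp_open_def
proof (intro conjI ballI)
  fix f assume f: "f \<in> {f \<in> Lp_space M p. Lp_norm M p (\<lambda>t. f t - a t) < c}"
  show "\<exists>\<epsilon>>0. \<forall>g\<in>Lp_space M p. Lp_norm M p (\<lambda>t. g t - f t) < \<epsilon> \<longrightarrow>
    g \<in> {f \<in> Lp_space M p. Lp_norm M p (\<lambda>t. f t - a t) < c}"
    using f Lp_norm_dist_triangle[OF p _ _ a, of _ f]
    by (intro exI[of _ "c - Lp_norm M p (\<lambda>t. f t - a t)"]) fastforce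
qed auto

lemma Lp_dist_measurable:
  assumes "1 \<le> p" and "a \<in> Lp_space M p"
  shows "(\<lambda>f. Lp_norm M p (\<lambda>t. f t - a t)) \<in> borel_measurable (Lp_borel M p)"
  unfolding borel_measurable_iff_less space_Lp_borel
  using Lp_open_in_sets[OF Lp_dist_less_open[OF assms]] by blast

section \<open>Voronoi cells\<close>

text \<open>The functions strictly closer to \<open>a i\<close> than to any other point. Ties are excluded in order to make
  the cell open: for \<open>p = 1\<close>, paths in it may then be modified on sets of small measure.\<close>

definition strict_cell ::
    "'t measure \<Rightarrow> real \<Rightarrow> nat \<Rightarrow> (nat \<Rightarrow> 't \<Rightarrow> real ^ 'd) \<Rightarrow> nat \<Rightarrow> ('t \<Rightarrow> real ^ 'd) set" where
  "strict_cell M p n a i = {f \<in> Lp_space M p. \<forall>k\<in>{1..n} - {i}.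
     Lp_norm M p (\<lambda>t. f t - a i t) < Lp_norm M p (\<lambda>t. f t - a k t)}"

text \<open>Stationarity may be tested on any Voronoi partition. Breaking ties in favour of the smallest
  index, except that \<open>i\<close> comes last, leaves to \<open>i\<close> precisely its strict cell.\<close>

lemma voronoi_partition_strict_cell:
  fixes M :: "'t measure" and a :: "nat \<Rightarrow> 't \<Rightarrow> real ^ 'd"
  assumes p: "1 \<le> p" and a: "\<And>k. k \<in> {1..n} \<Longrightarrow> a k \<in> Lp_space M p" and i: "i \<in> {1..n}"
  obtains C where "voronoi_partition M p n a C" and "C i = strict_cell M p n a i"
proof -
  define rk where "rk k = (if k = i then n + 1 else k)" for k :: nat
  define D where "D k f = Lp_norm M p (\<lambda>t. f t - a k t)" for k and f :: "'t \<Rightarrow> real ^ 'd"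
  define C where "C k = {f \<in> Lp_space M p. \<forall>l\<in>{1..n}. D k f \<le> D l f \<and> (rk l < rk k \<longrightarrow> D k f < D l f)}" for k
  have inj: "inj_on rk {1..n}" by (auto simp: inj_on_def rk_def)
  have [measurable]: "D k \<in> borel_measurable (Lp_borel M p)" if "k \<in> {1..n}" for k
    unfolding D_def using Lp_dist_measurable[OF p a[OF that]] .
  have sets: "C k \<in> sets (Lp_borel M p)" if [measurable]: "k \<in> {1..n}" for k
    unfolding C_def space_Lp_borel[symmetric] using that
    by (intro sets.sets_Collect_finite_All' sets.sets_Collect_conj sets.sets_Collect_imp
        sets.sets_Collect_const borel_measurable_le borel_measurable_less) (use i in auto)
  have disj: "disjoint_family_on C {1..n}"
    unfolding disjoint_family_on_def
  proof (intro ballI impI equals0I)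
    fix k l f assume *: "k \<in> {1..n}" "l \<in> {1..n}" "k \<noteq> l" "f \<in> C k \<inter> C l"
    then have "rk k \<noteq> rk l" using inj by (auto dest: inj_onD)
    then consider "rk k < rk l" | "rk l < rk k" by linarith
    then show False
    proof cases
      case 1
      then have "D l f < D k f" "D k f \<le> D l f" using * by (auto simp: C_def)
      then show False by simp
    next
      case 2
      then have "D k f < D l f" "D l f \<le> D k f" using * by (auto simp: C_def)
      then show False by simp
    qed
  qed
  have cover: "Lp_space M p \<subseteq> (\<Union>k\<in>{1..n}. C k)"
  proof
    fix f :: "'t \<Rightarrow> real ^ 'd" assume f: "f \<in> Lp_space M p"
    define m where "m = (MIN k\<in>{1..n}. D k f)"
    have ne: "finite ((\<lambda>k. D k f) ` {1..n})" "(\<lambda>k. D k f) ` {1..n} \<noteq> {}" using i by auto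
    have "m \<in> (\<lambda>k. D k f) ` {1..n}" unfolding m_def by (rule Min_in[OF ne])
    then obtain k0 where k0: "k0 \<in> {1..n}" "D k0 f = m" by auto
    have le: "m \<le> D l f" if "l \<in> {1..n}" for l unfolding m_def using ne that by auto
    obtain k where k: "k \<in> {1..n}" "D k f = m"
      and min: "\<And>l. l \<in> {1..n} \<Longrightarrow> D l f = m \<Longrightarrow> rk k \<le> rk l"
      using ex_has_least_nat[of "\<lambda>k. k \<in> {1..n} \<and> D k f = m" k0 rk] k0 by blast
    have "f \<in> C k" unfolding C_def using f k le min by (force simp: less_le)
    then show "f \<in> (\<Union>k\<in>{1..n}. C k)" using k by blast
  qed
  have sub: "f \<in> C k \<Longrightarrow> D k f = (MIN l\<in>{1..n}. D l f)" if "k \<in> {1..n}" for f k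
    using that by (intro Min_eqI[symmetric]) (auto simp: C_def)
  have "voronoi_partition M p n a C"
    unfolding voronoi_partition_def
    using sets disj cover sub by (auto simp: C_def D_def)
  moreover have "C i = strict_cell M p n a i"
    using i by (force simp: C_def strict_cell_def D_def rk_def less_imp_le)
  ultimately show ?thesis using that by blast
qed

lemma strict_cell_open:
  assumes p: "1 \<le> p" and a: "\<And>k. k \<in> {1..n} \<Longrightarrow> a k \<in> Lp_space M p" and i: "i \<in> {1..n}"
    and f: "f \<in> strict_cell M p n a i"
  obtains \<delta> where "\<delta> > 0"
    and "\<And>g. g \<in> Lp_space M p \<Longrightarrow> Lp_norm M p (\<lambda>t. g t - f t) < \<delta> \<Longrightarrow> g \<in> strict_cell M p n a i"
proof -
  define gap where "gap k = (Lp_norm M p (\<lambda>t. f t - a k t) - Lp_norm M p (\<lambda>t. f t - a i t)) / 2" for k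
  define \<delta> where "\<delta> = Min (insert 1 (gap ` ({1..n} - {i})))"
  have fL: "f \<in> Lp_space M p" using f by (simp add: strict_cell_def)
  have "\<delta> > 0" using f by (auto simp: \<delta>_def strict_cell_def gap_def)
  moreover have "g \<in> strict_cell M p n a i"
    if g: "g \<in> Lp_space M p" "Lp_norm M p (\<lambda>t. g t - f t) < \<delta>" for g
    unfolding strict_cell_def
  proof (intro CollectI conjI ballI)
    fix k assume k: "k \<in> {1..n} - {i}"
    then have "\<delta> \<le> gap k" by (auto simp: \<delta>_def)
    moreover have "Lp_norm M p (\<lambda>t. g t - a i t) \<le> Lp_norm M p (\<lambda>t. g t - f t) + Lp_norm M p (\<lambda>t. f t - a i t)"
      using Lp_norm_dist_triangle[OF p g(1) fL a[OF i]] .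
    moreover have "Lp_norm M p (\<lambda>t. f t - a k t) \<le> Lp_norm M p (\<lambda>t. g t - f t) + Lp_norm M p (\<lambda>t. g t - a k t)"
      using Lp_norm_dist_triangle[OF p fL g(1) a, of k] k by (simp add: Lp_norm_dist_commute[of M p f g])
    ultimately show "Lp_norm M p (\<lambda>t. g t - a i t) < Lp_norm M p (\<lambda>t. g t - a k t)"
      using g(2) unfolding gap_def by (simp add: field_simps)
  qed (use g in auto)
  ultimately show ?thesis using that by blast
qed

section \<open>Sign changes of monotone families\<close>

text \<open>The value at \<open>b\<close> is unspecified, so that \<open>b\<close> may be a jump: if a coordinate is almost surely equal
  to \<open>b\<close>, then the expected sign of \<open>y\<close> minus that coordinate jumps from \<open>-1\<close> to \<open>1\<close> at \<open>y = b\<close>.\<close>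

definition changes_sign_at :: "(real \<Rightarrow> real) \<Rightarrow> real \<Rightarrow> bool" where
  "changes_sign_at f b \<longleftrightarrow> (\<forall>y. (b < y \<longrightarrow> f y > 0) \<and> (y < b \<longrightarrow> f y < 0))"

lemma changes_sign_at_root: "changes_sign_at f b \<Longrightarrow> f y = 0 \<Longrightarrow> y = b"
  unfolding changes_sign_at_def by (metis less_irrefl linorder_neqE)

lemma changes_sign_at_le:
  assumes "changes_sign_at f b"
  shows "f z < 0 \<Longrightarrow> z \<le> b" and "f z > 0 \<Longrightarrow> b \<le> z"
  using assms unfolding changes_sign_at_def by (meson less_asym not_le)+

lemma changes_sign_at_unique:
  assumes "changes_sign_at f b" "changes_sign_at f c"
  shows "b = c"
proof -
  have "\<not> x < y" if "changes_sign_at f x" "changes_sign_at f y" for x y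
  proof
    assume "x < y"
    then obtain z where "x < z" "z < y" using dense by blast
    then have "f z > 0" "f z < 0" using that by (auto simp: changes_sign_at_def)
    then show False by simp
  qed
  then show ?thesis using assms by (meson linorder_neqE)
qed

lemma strict_mono_changes_sign:
  assumes mono: "strict_mono f" and neg: "f u < 0" and pos: "f v > 0"
  shows "\<exists>b. changes_sign_at f b"
proof -
  define S where "S = {y. f y \<le> 0}"
  have S: "y \<le> v" if "y \<in> S" for y
    using that pos strict_monoD[OF mono, of v y] by (force simp: S_def)
  then have bdd: "bdd_above S" by (rule bdd_aboveI)
  have "S \<noteq> {}" using neg by (auto simp: S_def intro: less_imp_le)
  have "f y > 0" if "Sup S < y" for y
    using that cSup_upper[OF _ bdd, of y] by (force simp: S_def)
  moreover have "f y < 0" if less: "y < Sup S" for y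
  proof -
    obtain z where "z \<in> S" "y < z" using less_cSupE[OF less \<open>S \<noteq> {}\<close>] by blast
    then show ?thesis using strict_monoD[OF mono, of y z] by (auto simp: S_def)
  qed
  ultimately show ?thesis by (auto simp: changes_sign_at_def)
qed

text \<open>The set where \<open>b t < y\<close> is the countable union of the sets where \<open>f t q > 0\<close> over rational \<open>q < y\<close>.\<close>

lemma sign_change_measurable:
  fixes f :: "'t \<Rightarrow> real \<Rightarrow> real"
  assumes b: "\<And>t. t \<in> space M \<Longrightarrow> changes_sign_at (f t) (b t)"
    and f: "\<And>y. (\<lambda>t. f t y) \<in> borel_measurable M"
  shows "b \<in> borel_measurable M"
  unfolding borel_measurable_iff_less
proof
  fix y :: real
  note [measurable] = f
  have "{t \<in> space M. b t < y} = (\<Union>q\<in>{q \<in> \<rat>. q < y}. {t \<in> space M. 0 < f t q})"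
  proof (intro set_eqI iffI)
    fix t assume t: "t \<in> {t \<in> space M. b t < y}"
    then obtain q where "q \<in> \<rat>" "b t < q" "q < y" using Rats_dense_in_real by blast
    then show "t \<in> (\<Union>q\<in>{q \<in> \<rat>. q < y}. {t \<in> space M. 0 < f t q})"
      using t b[of t] by (auto simp: changes_sign_at_def)
  next
    fix t assume "t \<in> (\<Union>q\<in>{q \<in> \<rat>. q < y}. {t \<in> space M. 0 < f t q})"
    then obtain q where q: "t \<in> space M" "q < y" "0 < f t q" by auto
    then have "\<not> q < b t" using b[of t] by (force simp: changes_sign_at_def)
    then show "t \<in> {t \<in> space M. b t < y}" using q by auto
  qed
  also have "\<dots> \<in> sets M"
    by (rule sets.countable_UN'') (auto intro: countable_subset[OF _ countable_rat])
  finally show "{t \<in> space M. b t < y} \<in> sets M" .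
qed

text \<open>Near \<open>c\<close> there are points on both sides at which \<open>g\<close> has strict signs; the functions \<open>f t\<close>
  eventually have the same signs there and trap \<open>b t\<close> between them.\<close>

lemma sign_change_tendsto:
  assumes b: "\<forall>\<^sub>F t in F. changes_sign_at (f t) (b t)" and c: "changes_sign_at g c"
    and lim: "\<And>y. y \<noteq> c \<Longrightarrow> ((\<lambda>t. f t y) \<longlongrightarrow> g y) F"
  shows "(b \<longlongrightarrow> c) F"
proof (rule order_tendstoI)
  fix y assume "y < c"
  then obtain z where z: "y < z" "z < c" using dense by blast
  then have "\<forall>\<^sub>F t in F. f t z < 0"
    using c lim[of z] by (intro order_tendstoD(2)[of _ "g z"]) (auto simp: changes_sign_at_def)
  with b show "\<forall>\<^sub>F t in F. y < b t"
    by eventually_elim (use z changes_sign_at_le in \<open>fastforce intro: less_le_trans le_less_trans\<close>)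
next
  fix y assume "c < y"
  then obtain z where z: "z < y" "c < z" using dense by blast
  then have "\<forall>\<^sub>F t in F. f t z > 0"
    using c lim[of z] by (intro order_tendstoD(1)[of _ "g z"]) (auto simp: changes_sign_at_def)
  with b show "\<forall>\<^sub>F t in F. b t < y"
    by eventually_elim (use z changes_sign_at_le in \<open>fastforce intro: less_le_trans le_less_trans\<close>)
qed

section \<open>Signed powers\<close>

definition signed_powr :: "real \<Rightarrow> real \<Rightarrow> real" where
  "signed_powr q z = \<bar>z\<bar> powr q * sgn z"

lemma signed_powr_measurable [measurable]: "signed_powr q \<in> borel_measurable borel"
  unfolding signed_powr_def by measurable

lemma signed_powr_minus: "signed_powr q (- z) = - signed_powr q z"
  by (simp add: signed_powr_def sgn_minus)

lemma abs_signed_powr: "\<bar>signed_powr q z\<bar> = \<bar>z\<bar> powr q"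
  by (simp add: signed_powr_def abs_mult abs_sgn_eq)

lemma signed_powr_nonneg: "0 \<le> z \<Longrightarrow> signed_powr q z = z powr q"
  by (cases "z = 0") (auto simp: signed_powr_def)

lemma signed_powr_pos_iff: "0 < signed_powr q z \<longleftrightarrow> 0 < z"
  by (auto simp: signed_powr_def zero_less_mult_iff sgn_if split: if_splits)

lemma signed_powr_zero_exponent: "signed_powr 0 z = sgn z"
  by (cases "z = 0") (auto simp: signed_powr_def)

lemma signed_powr_one: "signed_powr 1 z = z"
  by (auto simp: signed_powr_def abs_if sgn_if)

lemma signed_powr_mono:
  assumes "q \<ge> 0" "u \<le> v" shows "signed_powr q u \<le> signed_powr q v"
proof -
  consider "0 \<le> u" | "v \<le> 0" | "u < 0" "0 < v" by linarith
  then show ?thesis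
  proof cases
    case 1 then show ?thesis using assms by (simp add: signed_powr_nonneg powr_mono2)
  next
    case 2
    then have "signed_powr q (- v) \<le> signed_powr q (- u)"
      using assms by (simp only: signed_powr_nonneg) (auto intro: powr_mono2)
    then show ?thesis by (simp add: signed_powr_minus)
  next
    case 3 then show ?thesis by (auto simp: signed_powr_def sgn_if intro: order_trans[of _ 0])
  qed
qed

lemma signed_powr_strict_mono:
  assumes "q > 0" "u < v" shows "signed_powr q u < signed_powr q v"
proof -
  consider "0 \<le> u" | "v \<le> 0" | "u < 0" "0 < v" by linarith
  then show ?thesis
  proof cases
    case 1 then show ?thesis using assms by (simp add: signed_powr_nonneg powr_less_mono2)
  next
    case 2
    then have "signed_powr q (- v) < signed_powr q (- u)"
      using assms by (simp only: signed_powr_nonneg) (auto intro: powr_less_mono2)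
    then show ?thesis by (simp add: signed_powr_minus)
  next
    case 3 
    then have "signed_powr q u < 0" "0 < signed_powr q v"
      by (auto simp: signed_powr_def sgn_if)
    then show ?thesis by simp
  qed
qed

text \<open>If \<open>\<bar>u - v\<bar>\<close> is small relative to \<open>\<bar>u\<bar>\<close>, homogeneity reduces the claim to continuity of the power
  at \<open>1\<close>; otherwise \<open>\<bar>u - v\<bar>\<close> controls both \<open>\<bar>u\<bar>\<close> and \<open>\<bar>v\<bar>\<close>. This treats all exponents \<open>q > 0\<close> alike,
  whether the signed power is Hoelder or only locally Lipschitz continuous.\<close>

lemma signed_powr_diff_le:
  assumes q: "q > 0" and eta: "\<eta> > 0"
  obtains K where "K > 0"
    and "\<And>u v. \<bar>signed_powr q u - signed_powr q v\<bar> \<le> \<eta> * \<bar>u\<bar> powr q + K * \<bar>u - v\<bar> powr q"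
proof -
  have "((\<lambda>x::real. x powr q) \<longlongrightarrow> 1 powr q) (at 1)"
    by (intro tendsto_intros) auto
  then obtain \<theta> where th: "\<theta> > 0" "\<And>x. dist x 1 < \<theta> \<Longrightarrow> \<bar>x powr q - 1\<bar> < \<eta>"
    unfolding tendsto_iff eventually_at dist_real_def using eta
    by (auto; metis diff_self abs_zero powr_one_eq_one)
  define \<theta>' where "\<theta>' = min (\<theta> / 2) 1"
  have th': "\<theta>' > 0" "\<theta>' \<le> 1" "\<theta>' < \<theta>" using th(1) by (auto simp: \<theta>'_def)
  define K where "K = (1 / \<theta>') powr q + (1 + 1 / \<theta>') powr q"
  have "K > 0" using th' unfolding K_def by (intro add_pos_nonneg) auto
  moreover have "\<bar>signed_powr q u - signed_powr q v\<bar> \<le> \<eta> * \<bar>u\<bar> powr q + K * \<bar>u - v\<bar> powr q" for u v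
  proof (cases "\<bar>u - v\<bar> < \<theta>' * \<bar>u\<bar>")
    case True
    then have u: "u \<noteq> 0" by auto
    define x where "x = v / u"
    have v: "v = x * u" using u by (simp add: x_def)
    have "\<bar>u - v\<bar> = \<bar>x - 1\<bar> * \<bar>u\<bar>" unfolding v by (simp add: abs_mult[symmetric] algebra_simps)
    then have x: "\<bar>x - 1\<bar> < \<theta>'" using True u by simp
    then have x0: "x > 0" using th' by linarith
    have "signed_powr q v = x powr q * signed_powr q u"
      unfolding v signed_powr_def using x0 by (simp add: abs_mult sgn_mult powr_mult)
    then have "\<bar>signed_powr q u - signed_powr q v\<bar> = \<bar>(1 - x powr q) * signed_powr q u\<bar>"
      by (simp add: algebra_simps)
    also have "\<dots> = \<bar>1 - x powr q\<bar> * \<bar>u\<bar> powr q" by (simp add: abs_mult abs_signed_powr)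
    also have "\<dots> \<le> \<eta> * \<bar>u\<bar> powr q"
      using th(2)[of x] x th' by (intro mult_right_mono) (auto simp: dist_real_def abs_minus_commute)
    finally show ?thesis using \<open>K > 0\<close> by (smt (verit) mult_nonneg_nonneg powr_ge_zero)
  next
    case False
    then have u: "\<bar>u\<bar> \<le> 1 / \<theta>' * \<bar>u - v\<bar>" using th' by (simp add: field_simps)
    then have v: "\<bar>v\<bar> \<le> (1 + 1 / \<theta>') * \<bar>u - v\<bar>" by (simp add: distrib_right)
    have "\<bar>u\<bar> powr q \<le> (1 / \<theta>' * \<bar>u - v\<bar>) powr q" using q u by (intro powr_mono2) auto
    moreover have "\<bar>v\<bar> powr q \<le> ((1 + 1 / \<theta>') * \<bar>u - v\<bar>) powr q" using q v by (intro powr_mono2) auto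
    ultimately have "\<bar>u\<bar> powr q + \<bar>v\<bar> powr q \<le> K * \<bar>u - v\<bar> powr q"
      unfolding K_def distrib_right[of "(1 / \<theta>') powr q"] using th' by (simp only: powr_mult)
    moreover have "\<bar>signed_powr q u - signed_powr q v\<bar> \<le> \<bar>u\<bar> powr q + \<bar>v\<bar> powr q"
      using abs_triangle_ineq4[of "signed_powr q u" "signed_powr q v"] by (simp add: abs_signed_powr)
    ultimately show ?thesis using eta by (smt (verit) mult_nonneg_nonneg powr_ge_zero)
  qed
  ultimately show ?thesis using that by blast
qed

section \<open>The weighted stationarity equation\<close>

lemma abs_integral_le_integral:
  fixes f g :: "'a \<Rightarrow> real"
  assumes "integrable M f" "integrable M g" "\<And>x. x \<in> space M \<Longrightarrow> \<bar>f x\<bar> \<le> g x"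
  shows "\<bar>LINT x|M. f x\<bar> \<le> (LINT x|M. g x)"
  by (rule order_trans[OF integral_abs_bound integral_mono]) (use assms in auto)

text \<open>One coordinate \<open>Y\<close> of the process together with the random weight \<open>W\<close> of one cell, which is at most
  \<open>1\<close> if \<open>r = p\<close> and at most \<open>N powr (r - p)\<close> otherwise, for the distance \<open>N\<close> of the path to the
  centre of the cell. The bound on
  \<open>W \<omega> * z powr (p - 1)\<close> is what remains of this: it is obtained by comparing \<open>z\<close> with \<open>c * N \<omega>\<close>, and
  with the free scale \<open>c\<close> it takes the place of Hoelder's inequality with exponents \<open>(r - 1) / (r - p)\<close>
  and \<open>(r - 1) / (p - 1)\<close>.\<close>

locale weighted_process = prob_space P for P :: "'w measure" +
  fixes M :: "'t measure" and Y :: "'t \<Rightarrow> 'w \<Rightarrow> real" and W N :: "'w \<Rightarrow> real" and p r :: real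
  assumes p_ge_1: "1 \<le> p" and p_le_r: "p \<le> r"
    and Y_pair: "(\<lambda>(t, \<omega>). Y t \<omega>) \<in> borel_measurable (M \<Otimes>\<^sub>M P)"
    and Y_int: "\<And>t. t \<in> space M \<Longrightarrow> integrable P (\<lambda>\<omega>. \<bar>Y t \<omega>\<bar> powr (r - 1))"
    and W_meas [measurable]: "W \<in> borel_measurable P"
    and W_nonneg: "\<And>\<omega>. 0 \<le> W \<omega>"
    and N_int: "integrable P (\<lambda>\<omega>. N \<omega> powr (r - 1))"
    and weight_bound: "\<And>c z \<omega>. 0 < c \<Longrightarrow> 0 \<le> z \<Longrightarrow>
      W \<omega> * z powr (p - 1) \<le> c powr (p - 1) * N \<omega> powr (r - 1) + c powr (p - r) * z powr (r - 1)"
    and W_nonzero: "\<not> (AE \<omega> in P. W \<omega> = 0)"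
begin

text \<open>The expectation in the stationarity condition at time \<open>t\<close>, as a function of a candidate value \<open>y\<close>
  for the quantizer. For \<open>p > 1\<close> it is, up to a positive factor, the derivative of
  \<open>y \<mapsto> E (W * \<bar>y - Y t\<bar> powr p)\<close>.\<close>

definition balance :: "'t \<Rightarrow> real \<Rightarrow> real" where
  "balance t y = (LINT \<omega>|P. W \<omega> * signed_powr (p - 1) (y - Y t \<omega>))"

lemma Y_meas [measurable]: "t \<in> space M \<Longrightarrow> Y t \<in> borel_measurable P"
  using measurable_Pair2[OF Y_pair] by simp

lemma W_integrable: "integrable P W"
proof (rule Bochner_Integration.integrable_bound)
  show "integrable P (\<lambda>\<omega>. N \<omega> powr (r - 1) + 1)" using N_int by simp
  show "AE \<omega> in P. norm (W \<omega>) \<le> norm (N \<omega> powr (r - 1) + 1)"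
    using weight_bound[of 1 1] W_nonneg by auto
qed measurable

lemma W_expectation_pos: "(LINT \<omega>|P. W \<omega>) > 0"
proof -
  have "(LINT \<omega>|P. W \<omega>) \<noteq> 0"
    using W_nonzero integral_nonneg_eq_0_iff_AE[OF W_integrable] W_nonneg by simp
  moreover have "(LINT \<omega>|P. W \<omega>) \<ge> 0" using W_nonneg by simp
  ultimately show ?thesis by linarith
qed

lemma abs_powr_diff_integrable:
  assumes [measurable]: "f \<in> borel_measurable P" "g \<in> borel_measurable P"
    and f: "integrable P (\<lambda>\<omega>. \<bar>f \<omega>\<bar> powr (r - 1))" and g: "integrable P (\<lambda>\<omega>. \<bar>g \<omega>\<bar> powr (r - 1))"
  shows "integrable P (\<lambda>\<omega>. \<bar>f \<omega> - g \<omega>\<bar> powr (r - 1))"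
proof (rule Bochner_Integration.integrable_bound)
  show "integrable P (\<lambda>\<omega>. 2 powr (r - 1) * (\<bar>f \<omega>\<bar> powr (r - 1) + \<bar>g \<omega>\<bar> powr (r - 1)))"
    using f g by simp
  have "\<bar>u - v\<bar> powr (r - 1) \<le> 2 powr (r - 1) * (\<bar>u\<bar> powr (r - 1) + \<bar>v\<bar> powr (r - 1))" for u v :: real
  proof (cases "u = v")
    case False
    have "\<bar>u - v\<bar> powr (r - 1) \<le> (2 * max \<bar>u\<bar> \<bar>v\<bar>) powr (r - 1)"
      using p_ge_1 p_le_r by (intro powr_mono2) auto
    also have "\<dots> = 2 powr (r - 1) * max \<bar>u\<bar> \<bar>v\<bar> powr (r - 1)" by (simp add: powr_mult)
    also have "\<dots> \<le> 2 powr (r - 1) * (\<bar>u\<bar> powr (r - 1) + \<bar>v\<bar> powr (r - 1))"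
      by (intro mult_left_mono) (auto simp: max_def)
    finally show ?thesis .
  qed auto
  then show "AE \<omega> in P. norm (\<bar>f \<omega> - g \<omega>\<bar> powr (r - 1))
    \<le> norm (2 powr (r - 1) * (\<bar>f \<omega>\<bar> powr (r - 1) + \<bar>g \<omega>\<bar> powr (r - 1)))"
    by simp
qed measurable

lemma weighted_powr_integrable:
  assumes [measurable]: "f \<in> borel_measurable P" and f: "integrable P (\<lambda>\<omega>. \<bar>f \<omega>\<bar> powr (r - 1))"
  shows "integrable P (\<lambda>\<omega>. W \<omega> * \<bar>f \<omega>\<bar> powr (p - 1))"
proof (rule Bochner_Integration.integrable_bound)
  show "integrable P (\<lambda>\<omega>. N \<omega> powr (r - 1) + \<bar>f \<omega>\<bar> powr (r - 1))" using N_int f by simp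
  show "AE \<omega> in P. norm (W \<omega> * \<bar>f \<omega>\<bar> powr (p - 1)) \<le> norm (N \<omega> powr (r - 1) + \<bar>f \<omega>\<bar> powr (r - 1))"
    using weight_bound[of 1 "\<bar>f _\<bar>"] W_nonneg by (auto simp: abs_mult)
qed measurable

lemma weighted_powr_expectation_le:
  assumes [measurable]: "f \<in> borel_measurable P" and f: "integrable P (\<lambda>\<omega>. \<bar>f \<omega>\<bar> powr (r - 1))"
    and c: "c > 0"
  shows "(LINT \<omega>|P. W \<omega> * \<bar>f \<omega>\<bar> powr (p - 1)) \<le>
    c powr (p - 1) * (LINT \<omega>|P. N \<omega> powr (r - 1)) + c powr (p - r) * (LINT \<omega>|P. \<bar>f \<omega>\<bar> powr (r - 1))"
proof -
  have "(LINT \<omega>|P. W \<omega> * \<bar>f \<omega>\<bar> powr (p - 1)) \<le>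
    (LINT \<omega>|P. c powr (p - 1) * N \<omega> powr (r - 1) + c powr (p - r) * \<bar>f \<omega>\<bar> powr (r - 1))"
    using weighted_powr_integrable[OF assms(1,2)] N_int f weight_bound[OF c] by (intro integral_mono) auto
  then show ?thesis using N_int f by simp
qed

lemma shift_integrable:
  "t \<in> space M \<Longrightarrow> integrable P (\<lambda>\<omega>. \<bar>y - Y t \<omega>\<bar> powr (r - 1))"
  using abs_powr_diff_integrable[of "\<lambda>_. y" "Y t"] Y_int by simp

lemma balance_integrable:
  assumes t [measurable]: "t \<in> space M"
  shows "integrable P (\<lambda>\<omega>. W \<omega> * signed_powr (p - 1) (y - Y t \<omega>))"
proof (rule Bochner_Integration.integrable_bound)
  show "integrable P (\<lambda>\<omega>. W \<omega> * \<bar>y - Y t \<omega>\<bar> powr (p - 1))"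
    using shift_integrable[OF t] by (intro weighted_powr_integrable) auto
qed (auto simp: abs_mult abs_signed_powr)

lemma balance_measurable: "(\<lambda>t. balance t y) \<in> borel_measurable M"
proof -
  have [measurable]: "(\<lambda>x. Y (fst x) (snd x)) \<in> borel_measurable (M \<Otimes>\<^sub>M P)"
    using Y_pair by (simp add: case_prod_beta')
  show ?thesis unfolding balance_def by measurable
qed

lemma balance_strict:
  assumes t: "t \<in> space M" and uv: "u \<le> v"
    and ne: "\<not> (AE \<omega> in P. W \<omega> = 0 \<or> signed_powr (p - 1) (v - Y t \<omega>) = signed_powr (p - 1) (u - Y t \<omega>))"
  shows "balance t u < balance t v"
proof -
  define D where "D \<omega> = W \<omega> * signed_powr (p - 1) (v - Y t \<omega>) - W \<omega> * signed_powr (p - 1) (u - Y t \<omega>)" for \<omega>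
  have int: "integrable P D" unfolding D_def using balance_integrable[OF t] by simp
  have nn: "D \<omega> \<ge> 0" for \<omega>
    unfolding D_def using W_nonneg uv p_ge_1 signed_powr_mono[of "p - 1" "u - Y t \<omega>" "v - Y t \<omega>"]
    by (simp add: mult_left_mono)
  have "(D \<omega> = 0) = (W \<omega> = 0 \<or> signed_powr (p - 1) (v - Y t \<omega>) = signed_powr (p - 1) (u - Y t \<omega>))" for \<omega>
    by (simp add: D_def)
  then have "\<not> (AE \<omega> in P. D \<omega> = 0)" using ne by simp
  then have "integral\<^sup>L P D \<noteq> 0"
    using integral_nonneg_eq_0_iff_AE[OF int] nn by simp
  moreover have "integral\<^sup>L P D \<ge> 0" using nn by simp
  moreover have "integral\<^sup>L P D = balance t v - balance t u"
    unfolding D_def balance_def using balance_integrable[OF t] by simp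
  ultimately show ?thesis by linarith
qed

text \<open>As \<open>y\<close> grows, the integrand truncated at \<open>1\<close> tends to the weight itself, which has positive
  expectation; the truncation provides the dominating function.\<close>

lemma balance_ex_pos:
  assumes t [measurable]: "t \<in> space M"
  shows "\<exists>y. balance t y > 0"
proof -
  \<comment> \<open>The truncated integrand increases with \<open>k\<close>, so the value at \<open>k = 0\<close> bounds it from below.\<close>
  define G where "G k \<omega> = W \<omega> * min 1 (signed_powr (p - 1) (real k - Y t \<omega>))" for k \<omega>
  have lim: "(\<lambda>k. G k \<omega>) \<longlonglongrightarrow> W \<omega>" for \<omega>
  proof (rule tendsto_eventually)
    obtain k0 :: nat where k0: "Y t \<omega> + 1 \<le> real k0" using real_arch_simple by blast
    show "\<forall>\<^sub>F k in sequentially. G k \<omega> = W \<omega>"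
      using eventually_ge_at_top[of k0]
    proof eventually_elim
      case (elim k)
      have "1 \<le> real k - Y t \<omega>" using k0 elim by linarith
      then have "1 \<le> signed_powr (p - 1) (real k - Y t \<omega>)"
        using p_ge_1 by (simp add: signed_powr_nonneg ge_one_powr_ge_zero)
      then show ?case by (simp add: G_def)
    qed
  qed
  have "(\<lambda>k. integral\<^sup>L P (G k)) \<longlonglongrightarrow> integral\<^sup>L P W"
  proof (rule integral_dominated_convergence)
    show "integrable P (\<lambda>\<omega>. W \<omega> + \<bar>W \<omega> * signed_powr (p - 1) (0 - Y t \<omega>)\<bar>)"
      using W_integrable balance_integrable[OF t, of 0] by simp
    fix k
    show "G k \<in> borel_measurable P" unfolding G_def[abs_def] by measurable
    have "signed_powr (p - 1) (0 - Y t \<omega>) \<le> signed_powr (p - 1) (real k - Y t \<omega>)" for \<omega>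
      using p_ge_1 by (intro signed_powr_mono) auto
    then have "\<bar>min 1 (signed_powr (p - 1) (real k - Y t \<omega>))\<bar> \<le> 1 + \<bar>signed_powr (p - 1) (0 - Y t \<omega>)\<bar>" for \<omega>
      by (smt (verit))
    then have "W \<omega> * \<bar>min 1 (signed_powr (p - 1) (real k - Y t \<omega>))\<bar> \<le> W \<omega> * (1 + \<bar>signed_powr (p - 1) (0 - Y t \<omega>)\<bar>)" for \<omega>
      using W_nonneg by (intro mult_left_mono) auto
    then show "AE \<omega> in P. norm (G k \<omega>) \<le> W \<omega> + \<bar>W \<omega> * signed_powr (p - 1) (0 - Y t \<omega>)\<bar>"
      using W_nonneg by (auto simp: G_def abs_mult distrib_left)
  qed (use lim in auto)
  then have "\<forall>\<^sub>F k in sequentially. 0 < integral\<^sup>L P (G k)"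
    using W_expectation_pos by (auto dest: order_tendstoD(1))
  then obtain k where k: "0 < integral\<^sup>L P (G k)" by (auto simp: eventually_sequentially)
  then have "integrable P (G k)" using not_integrable_integral_eq by force
  then have "integral\<^sup>L P (G k) \<le> balance t (real k)"
    unfolding balance_def
    by (rule integral_mono[OF _ balance_integrable[OF t]]) (auto simp: G_def intro!: mult_left_mono W_nonneg)
  with k show ?thesis by (intro exI[of _ "real k"]) linarith
qed

lemma reflected: "weighted_process P M (\<lambda>t \<omega>. - Y t \<omega>) W N p r"
proof unfold_locales
  show "(\<lambda>(t, \<omega>). - Y t \<omega>) \<in> borel_measurable (M \<Otimes>\<^sub>M P)"
    using Y_pair by (simp add: case_prod_beta')
qed (use p_ge_1 p_le_r Y_int W_nonneg N_int weight_bound W_nonzero in auto)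

lemma balance_reflected: "weighted_process.balance P (\<lambda>t \<omega>. - Y t \<omega>) W p t y = - balance t (- y)"
proof -
  have "signed_powr (p - 1) (y - - Y t \<omega>) = - signed_powr (p - 1) (- y - Y t \<omega>)" for \<omega>
    unfolding signed_powr_minus[symmetric] by (rule arg_cong[where f = "signed_powr (p - 1)"]) simp
  then show ?thesis
    unfolding weighted_process.balance_def[OF reflected] balance_def
    by (simp only: mult_minus_right integral_minus)
qed

text \<open>Reflecting \<open>Y\<close> exchanges the two signs.\<close>

lemma balance_ex_neg: "t \<in> space M \<Longrightarrow> \<exists>y. balance t y < 0"
  using weighted_process.balance_ex_pos[OF reflected, of t] by (auto simp: balance_reflected)

lemma balance_changes_sign:
  assumes "t \<in> space M" and "strict_mono (balance t)"
  shows "\<exists>b. changes_sign_at (balance t) b"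
  using balance_ex_neg[OF assms(1)] balance_ex_pos[OF assms(1)] strict_mono_changes_sign[OF assms(2)]
  by blast

lemma balance_strict_mono:
  assumes t: "t \<in> space M" and "p > 1"
  shows "strict_mono (balance t)"
proof (rule strict_monoI)
  fix u v :: real assume "u < v"
  then have "signed_powr (p - 1) (v - Y t \<omega>) \<noteq> signed_powr (p - 1) (u - Y t \<omega>)" for \<omega>
    using signed_powr_strict_mono[of "p - 1" "u - Y t \<omega>" "v - Y t \<omega>"] assms by force
  then show "balance t u < balance t v"
    using \<open>u < v\<close> W_nonzero by (intro balance_strict[OF t]) simp_all
qed

text \<open>A deterministic coordinate puts all the weight on one side of its value.\<close>

lemma balance_changes_sign_const:
  assumes t: "t \<in> space M" and Y: "AE \<omega> in P. Y t \<omega> = x"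
  shows "changes_sign_at (balance t) x"
proof -
  have "balance t y = (LINT \<omega>|P. W \<omega> * signed_powr (p - 1) (y - x))" for y
    unfolding balance_def using t Y by (intro integral_cong_AE) auto
  then have "balance t y = (LINT \<omega>|P. W \<omega>) * signed_powr (p - 1) (y - x)" for y by simp
  moreover have "signed_powr (p - 1) (y - x) < 0 \<longleftrightarrow> y < x" for y
    using signed_powr_pos_iff[of "p - 1" "x - y"] signed_powr_minus[of "p - 1" "x - y"] by simp
  ultimately show ?thesis
    using W_expectation_pos by (auto simp: changes_sign_at_def mult_pos_neg signed_powr_pos_iff)
qed

subsection \<open>The strictly convex case\<close>

text \<open>For \<open>r > 1\<close> and a single coordinate this is the intrinsic semimetric raised to the power
  \<open>max (r - 1) 1\<close>.\<close>

definition moment_gap :: "'t \<Rightarrow> 't \<Rightarrow> real" where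
  "moment_gap s t = (LINT \<omega>|P. \<bar>Y s \<omega> - Y t \<omega>\<bar> powr (r - 1))"

lemma gap_integrable:
  "s \<in> space M \<Longrightarrow> t \<in> space M \<Longrightarrow> integrable P (\<lambda>\<omega>. \<bar>Y s \<omega> - Y t \<omega>\<bar> powr (r - 1))"
  by (intro abs_powr_diff_integrable Y_int Y_meas)

text \<open>The increment of the signed power splits into a part relative to \<open>\<bar>y - Y s\<bar>\<close> and one relative to
  \<open>\<bar>Y s - Y t\<bar>\<close>. The first is made small by \<open>\<eta>\<close>; in the second, the weight bound leaves a multiple of
  the fixed moment of \<open>N\<close>, made small by \<open>c\<close>, and then a multiple of the gap, made small by \<open>\<delta>\<close>.\<close>

lemma balance_continuous:
  assumes p: "p > 1" and s: "s \<in> space M" and e: "e > 0"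
  shows "\<exists>\<delta>>0. \<forall>t\<in>space M. moment_gap s t < \<delta> \<longrightarrow> \<bar>balance t y - balance s y\<bar> < e"
proof -
  define A where "A = (LINT \<omega>|P. W \<omega> * \<bar>y - Y s \<omega>\<bar> powr (p - 1))"
  define B where "B = (LINT \<omega>|P. N \<omega> powr (r - 1))"
  have A: "A \<ge> 0" and B: "B \<ge> 0" unfolding A_def B_def using W_nonneg by auto
  define \<eta> where "\<eta> = e / (4 * (A + 1))"
  have eta: "\<eta> > 0" "\<eta> * A \<le> e / 4" using A e by (auto simp: \<eta>_def field_simps)
  obtain K where K: "K > 0"
    and diff: "\<And>u v. \<bar>signed_powr (p - 1) u - signed_powr (p - 1) v\<bar> \<le> \<eta> * \<bar>u\<bar> powr (p - 1) + K * \<bar>u - v\<bar> powr (p - 1)"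
    using signed_powr_diff_le[of "p - 1" \<eta>] p eta by auto
  define c where "c = (e / (4 * K * (B + 1))) powr (1 / (p - 1))"
  have c: "c > 0" using e K B by (auto simp: c_def)
  have "c powr (p - 1) = e / (4 * K * (B + 1))" using p e K B by (auto simp: c_def powr_powr)
  then have "K * (c powr (p - 1) * B) = e / 4 * (B / (B + 1))" using K B by simp
  also have "\<dots> \<le> e / 4 * 1" using e B by (intro mult_left_mono) auto
  finally have cB: "K * (c powr (p - 1) * B) \<le> e / 4" by simp
  define \<delta> where "\<delta> = e / (4 * K * c powr (p - r))"
  have "\<delta> > 0" using e K c by (simp add: \<delta>_def)
  moreover have "\<bar>balance t y - balance s y\<bar> < e" if t: "t \<in> space M" and gap: "moment_gap s t < \<delta>" for t
  proof -
    note [measurable] = s t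
    have "\<bar>balance t y - balance s y\<bar> =
      \<bar>LINT \<omega>|P. W \<omega> * signed_powr (p - 1) (y - Y s \<omega>) - W \<omega> * signed_powr (p - 1) (y - Y t \<omega>)\<bar>"
      unfolding balance_def using balance_integrable[OF s] balance_integrable[OF t] by simp
    also have "\<dots> \<le> (LINT \<omega>|P. \<eta> * (W \<omega> * \<bar>y - Y s \<omega>\<bar> powr (p - 1)) + K * (W \<omega> * \<bar>Y s \<omega> - Y t \<omega>\<bar> powr (p - 1)))"
    proof (rule abs_integral_le_integral)
      fix \<omega>
      have "\<bar>W \<omega> * signed_powr (p - 1) (y - Y s \<omega>) - W \<omega> * signed_powr (p - 1) (y - Y t \<omega>)\<bar>
        = W \<omega> * \<bar>signed_powr (p - 1) (y - Y s \<omega>) - signed_powr (p - 1) (y - Y t \<omega>)\<bar>"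
        using W_nonneg by (simp add: right_diff_distrib[symmetric] abs_mult)
      also have "\<dots> \<le> W \<omega> * (\<eta> * \<bar>y - Y s \<omega>\<bar> powr (p - 1) + K * \<bar>(y - Y s \<omega>) - (y - Y t \<omega>)\<bar> powr (p - 1))"
        by (intro mult_left_mono diff W_nonneg)
      finally show "\<bar>W \<omega> * signed_powr (p - 1) (y - Y s \<omega>) - W \<omega> * signed_powr (p - 1) (y - Y t \<omega>)\<bar>
        \<le> \<eta> * (W \<omega> * \<bar>y - Y s \<omega>\<bar> powr (p - 1)) + K * (W \<omega> * \<bar>Y s \<omega> - Y t \<omega>\<bar> powr (p - 1))"
        by (simp add: algebra_simps abs_minus_commute)
    qed (use balance_integrable s t shift_integrable gap_integrable weighted_powr_integrable in auto)
    also have "\<dots> = \<eta> * A + K * (LINT \<omega>|P. W \<omega> * \<bar>Y s \<omega> - Y t \<omega>\<bar> powr (p - 1))"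
      unfolding A_def using s t shift_integrable gap_integrable weighted_powr_integrable by simp
    also have "\<dots> \<le> \<eta> * A + K * (c powr (p - 1) * B + c powr (p - r) * moment_gap s t)"
      unfolding B_def moment_gap_def using K s t c gap_integrable
      by (intro add_left_mono mult_left_mono weighted_powr_expectation_le) auto
    also have "\<dots> < \<eta> * A + K * (c powr (p - 1) * B + c powr (p - r) * \<delta>)"
      using K c gap by simp
    also have "\<dots> = \<eta> * A + K * (c powr (p - 1) * B) + e / 4"
      using K c by (simp add: \<delta>_def field_simps)
    also have "\<dots> \<le> e / 4 + e / 4 + e / 4" using eta cB by (intro add_mono) auto
    also have "\<dots> < e" using e by simp
    finally show ?thesis .
  qed
  ultimately show ?thesis by blast
qed

lemma sign_change_continuous:
  assumes p: "p > 1" and b: "\<And>t. t \<in> space M \<Longrightarrow> changes_sign_at (balance t) (b t)"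
    and s: "s \<in> space M" and e: "e > 0"
  shows "\<exists>\<delta>>0. \<forall>t\<in>space M. moment_gap s t < \<delta> \<longrightarrow> \<bar>b s - b t\<bar> < e"
proof -
  \<comment> \<open>The filter of the neighbourhoods of \<open>s\<close> in the gap.\<close>
  define F where "F = (INF \<delta>\<in>{0<..}. principal {t \<in> space M. moment_gap s t < \<delta>})"
  have ev: "eventually Q F \<longleftrightarrow> (\<exists>\<delta>>0. \<forall>t\<in>space M. moment_gap s t < \<delta> \<longrightarrow> Q t)" for Q
  proof -
    have "eventually Q F \<longleftrightarrow> (\<exists>\<delta>\<in>{0<..}. eventually Q (principal {t \<in> space M. moment_gap s t < \<delta>}))"
      unfolding F_def
    proof (rule eventually_INF_base)
      fix a b :: real assume "a \<in> {0<..}" "b \<in> {0<..}"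
      then show "\<exists>x\<in>{0<..}. principal {t \<in> space M. moment_gap s t < x}
        \<le> inf (principal {t \<in> space M. moment_gap s t < a}) (principal {t \<in> space M. moment_gap s t < b})"
        by (intro bexI[of _ "min a b"]) auto
    qed auto
    then show ?thesis by (auto simp: eventually_principal)
  qed
  have "(b \<longlongrightarrow> b s) F"
  proof (rule sign_change_tendsto[where f = balance])
    show "\<forall>\<^sub>F t in F. changes_sign_at (balance t) (b t)"
      unfolding ev using b by (intro exI[of _ 1]) auto
    show "((\<lambda>t. balance t y) \<longlongrightarrow> balance s y) F" for y
      unfolding tendsto_iff ev dist_real_def using balance_continuous[OF p s] by blast
  qed (rule b[OF s])
  then show ?thesis unfolding tendsto_iff ev dist_real_def using e
    by (simp add: abs_minus_commute)
qed

subsection \<open>The quadratic case\<close>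

text \<open>For \<open>p = 2\<close> the balance is affine in \<open>y\<close>, and its root is the weighted mean of \<open>Y t\<close>.\<close>

lemma sign_change_quadratic:
  assumes p: "p = 2" and t: "t \<in> space M" and b: "changes_sign_at (balance t) b"
  shows "integrable P (\<lambda>\<omega>. W \<omega> * Y t \<omega>)"
    and "(LINT \<omega>|P. W \<omega>) * b = (LINT \<omega>|P. W \<omega> * Y t \<omega>)"
proof -
  show int: "integrable P (\<lambda>\<omega>. W \<omega> * Y t \<omega>)"
    using balance_integrable[OF t, of 0] by (simp add: p signed_powr_one)
  have bal: "balance t y = (LINT \<omega>|P. W \<omega>) * y - (LINT \<omega>|P. W \<omega> * Y t \<omega>)" for y
    unfolding balance_def using int W_integrable by (simp add: p signed_powr_one right_diff_distrib)
  define y where "y = (LINT \<omega>|P. W \<omega> * Y t \<omega>) / (LINT \<omega>|P. W \<omega>)"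
  have "balance t y = 0" using W_expectation_pos by (simp add: bal y_def)
  then have "y = b" using changes_sign_at_root[OF b] by simp
  then show "(LINT \<omega>|P. W \<omega>) * b = (LINT \<omega>|P. W \<omega> * Y t \<omega>)"
    using W_expectation_pos by (auto simp: y_def)
qed

text \<open>The difference of two weighted means is bounded by \<open>E (W * \<bar>Y s - Y t\<bar>)\<close>. The choice of the scale
  \<open>c = D\<close>, the semimetric distance, makes both terms of the weight bound linear in \<open>D\<close>; if \<open>D = 0\<close>,
  letting \<open>c\<close> tend to \<open>0\<close> shows that the bound vanishes.\<close>

lemma sign_change_lipschitz:
  assumes p: "p = 2" and b: "\<And>t. t \<in> space M \<Longrightarrow> changes_sign_at (balance t) (b t)"
  shows "\<exists>L\<ge>0. \<forall>s\<in>space M. \<forall>t\<in>space M. \<bar>b s - b t\<bar> \<le> L * moment_gap s t powr (1 / (r - 1))"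
proof (intro exI conjI ballI)
  define E where "E = (LINT \<omega>|P. W \<omega>)"
  define B where "B = (LINT \<omega>|P. N \<omega> powr (r - 1))"
  have E: "E > 0" unfolding E_def by (rule W_expectation_pos)
  have B: "B \<ge> 0" unfolding B_def by simp
  show "(B + 1) / E \<ge> 0" using E B by simp
  fix s t assume s: "s \<in> space M" and t: "t \<in> space M"
  note [measurable] = s t
  define D where "D = moment_gap s t powr (1 / (r - 1))"
  have D0: "D \<ge> 0" by (simp add: D_def)
  have gap: "moment_gap s t \<ge> 0" by (simp add: moment_gap_def)
  have r: "r \<ge> 2" using p p_le_r by simp
  have D: "D powr (r - 1) = moment_gap s t" using gap r by (simp add: D_def powr_powr)
  define V where "V = (LINT \<omega>|P. W \<omega> * \<bar>Y s \<omega> - Y t \<omega>\<bar> powr (p - 1))"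
  have V: "V \<le> c * B + c powr (2 - r) * D powr (r - 1)" if "c > 0" for c
    using weighted_powr_expectation_le[of "\<lambda>\<omega>. Y s \<omega> - Y t \<omega>" c] gap_integrable[OF s t] that s t
    unfolding D V_def B_def moment_gap_def by (simp add: p)
  have le: "V \<le> (B + 1) * D"
  proof (cases "D = 0")
    case False
    then have "D powr (2 - r) * D powr (r - 1) = D"
      using D0 by (simp add: powr_add[symmetric])
    then show ?thesis using V[of D] False D0 by (simp add: algebra_simps)
  next
    case True
    have "V \<le> e" if "e > 0" for e
    proof -
      have "V \<le> e / (B + 1) * B" using V[of "e / (B + 1)"] that B True by simp
      also have "\<dots> \<le> e" using that B by (simp add: field_simps)
      finally show ?thesis .
    qed
    then have "V \<le> 0" using field_le_epsilon[of V 0] by simp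
    then show ?thesis using True by simp
  qed
  have "E * \<bar>b s - b t\<bar> = \<bar>LINT \<omega>|P. W \<omega> * Y s \<omega> - W \<omega> * Y t \<omega>\<bar>"
  proof -
    have "E * \<bar>b s - b t\<bar> = \<bar>E * b s - E * b t\<bar>"
      using E by (simp add: right_diff_distrib[symmetric] abs_mult)
    then show ?thesis
      using sign_change_quadratic[OF p s b[OF s]] sign_change_quadratic[OF p t b[OF t]] by (simp add: E_def)
  qed
  also have "\<dots> \<le> V"
    unfolding V_def
  proof (rule abs_integral_le_integral)
    show "integrable P (\<lambda>\<omega>. W \<omega> * \<bar>Y s \<omega> - Y t \<omega>\<bar> powr (p - 1))"
      using gap_integrable[OF s t] s t by (intro weighted_powr_integrable) auto
    show "\<bar>W \<omega> * Y s \<omega> - W \<omega> * Y t \<omega>\<bar> \<le> W \<omega> * \<bar>Y s \<omega> - Y t \<omega>\<bar> powr (p - 1)" for \<omega>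
      using W_nonneg by (simp add: p right_diff_distrib[symmetric] abs_mult)
  qed (use sign_change_quadratic(1)[OF p _ b] s t in auto)
  also note le
  finally have "\<bar>b s - b t\<bar> \<le> (B + 1) * D / E" using E by (simp add: le_divide_eq mult.commute)
  then show "\<bar>b s - b t\<bar> \<le> (B + 1) / E * moment_gap s t powr (1 / (r - 1))"
    unfolding D_def by simp
qed

end

section \<open>From stationary quantizers to weighted equations\<close>

lemma vec_measurableI:
  fixes f :: "'a \<Rightarrow> real ^ 'd"
  assumes "\<And>j. (\<lambda>t. f t $ j) \<in> borel_measurable M"
  shows "f \<in> borel_measurable M"
  by (subst borel_measurable_euclidean_space)
     (auto simp: Basis_vec_def cart_eq_inner_axis[symmetric] assms)

lemma norm_diff_le_card_mult:
  fixes x y :: "real ^ 'd"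
  assumes "\<And>j. \<bar>x $ j - y $ j\<bar> \<le> e"
  shows "norm (x - y) \<le> real CARD('d) * e"
proof -
  have "norm (x - y) \<le> (\<Sum>j\<in>UNIV. \<bar>(x - y) $ j\<bar>)" by (rule norm_le_l1_cart)
  also have "\<dots> \<le> (\<Sum>j\<in>(UNIV :: 'd set). e)" using assms by (intro sum_mono) simp
  finally show ?thesis by simp
qed

lemma epowr_measurable [measurable]: "(\<lambda>y. epowr y s) \<in> borel_measurable borel"
  unfolding epowr_def by measurable

locale stationary_process = prob_space P + M: finite_measure M
  for P :: "'w measure" and M :: "'t measure" +
  fixes X :: "'t \<Rightarrow> 'w \<Rightarrow> real ^ 'd" and a :: "nat \<Rightarrow> 't \<Rightarrow> real ^ 'd" and n :: nat and p r :: real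
  assumes p_ge_1: "1 \<le> p" and p_le_r: "p \<le> r"
    and bimeasurable: "bimeasurable P M X"
    and path_moment: "finite_path_moment P M p r X"
    and random_vector: "\<And>t. t \<in> space M \<Longrightarrow> Lq_random_vector P (r - 1) (X t)"
    and stationary: "stationary_quantizer P M p r X n a"
begin

definition path_dist :: "('t \<Rightarrow> real ^ 'd) \<Rightarrow> 'w \<Rightarrow> real" where
  "path_dist g \<omega> = Lp_norm M p (\<lambda>t. X t \<omega> - g t)"

definition cell_weight :: "nat \<Rightarrow> 'w \<Rightarrow> real" where
  "cell_weight i \<omega> = indicator (strict_cell M p n a i) (\<lambda>t. X t \<omega>) *
     (if r = p then 1 else path_dist (a i) \<omega> powr (r - p))"

lemma p_pos: "p > 0" and r_pos: "r > 0"
  using p_ge_1 p_le_r by auto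

lemma a_Lp: "i \<in> {1..n} \<Longrightarrow> a i \<in> Lp_space M p"
  using stationary by (auto simp: stationary_quantizer_def quantizer_def)

lemma X_joint [measurable]: "(\<lambda>x. X (snd x) (fst x)) \<in> borel_measurable (P \<Otimes>\<^sub>M M)"
  using bimeasurable by (simp add: bimeasurable_def case_prod_beta')

lemma X_section [measurable]: "t \<in> space M \<Longrightarrow> X t \<in> borel_measurable P"
  using random_vector by (simp add: Lq_random_vector_def)

lemma path_measurable: "\<omega> \<in> space P \<Longrightarrow> (\<lambda>t. X t \<omega>) \<in> borel_measurable M"
  using measurable_Pair2[OF X_joint] by simp

lemma Lp_measurable: "g \<in> Lp_space M p \<Longrightarrow> g \<in> borel_measurable M"
  by (simp add: Lp_space_def)

lemma path_dist_measurable: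
  assumes "g \<in> Lp_space M p"
  shows "path_dist g \<in> borel_measurable P"
proof -
  note [measurable] = Lp_measurable[OF assms]
  have "path_dist g = (\<lambda>\<omega>. (LINT t|M. (\<Sum>j\<in>UNIV. \<bar>X t \<omega> $ j - g t $ j\<bar> powr p)) powr (1 / p))"
    by (simp add: path_dist_def[abs_def] Lp_norm_eq_energy[OF p_pos] Lp_energy_def)
  also have "\<dots> \<in> borel_measurable P" by measurable
  finally show ?thesis .
qed

text \<open>The value \<open>\<infinity>\<close> records the paths outside of \<open>Lp_space M p\<close>.\<close>

definition path_energy :: "'w \<Rightarrow> ennreal" where
  "path_energy \<omega> = (\<integral>\<^sup>+t. ennreal (\<Sum>j\<in>UNIV. \<bar>X t \<omega> $ j\<bar> powr p) \<partial>M)"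

lemma path_energy_measurable [measurable]: "path_energy \<in> borel_measurable P"
  unfolding path_energy_def by measurable

lemma path_energy_moment: "(\<integral>\<^sup>+\<omega>. epowr (path_energy \<omega>) (r / p) \<partial>P) < \<infinity>"
  using path_moment unfolding finite_path_moment_def path_energy_def ell_norm_powr[OF p_pos] .

lemma path_in_Lp_iff: "\<omega> \<in> space P \<Longrightarrow> (\<lambda>t. X t \<omega>) \<in> Lp_space M p \<longleftrightarrow> path_energy \<omega> < \<infinity>"
  using path_measurable[of \<omega>]
  by (auto simp: Lp_space_iff[OF p_pos] path_energy_def integrable_iff_bounded sum_nonneg)

lemma AE_path_in_Lp: "AE \<omega> in P. (\<lambda>t. X t \<omega>) \<in> Lp_space M p"
proof -
  have "AE \<omega> in P. epowr (path_energy \<omega>) (r / p) \<noteq> \<infinity>"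
    using path_energy_moment by (intro nn_integral_PInf_AE) auto
  then show ?thesis
    by (rule AE_mp) (auto intro!: AE_I2 simp: path_in_Lp_iff epowr_def less_top)
qed

lemma path_norm_moment: "integrable P (\<lambda>\<omega>. path_dist (\<lambda>_. 0) \<omega> powr r)"
proof (rule integrableI_bounded)
  have zero: "(\<lambda>_. 0) \<in> Lp_space M p" by (simp add: Lp_space_iff[OF p_pos])
  show "(\<lambda>\<omega>. path_dist (\<lambda>_. 0) \<omega> powr r) \<in> borel_measurable P"
    using path_dist_measurable[OF zero] by measurable
  have "(\<integral>\<^sup>+\<omega>. ennreal (norm (path_dist (\<lambda>_. 0) \<omega> powr r)) \<partial>P) \<le> (\<integral>\<^sup>+\<omega>. epowr (path_energy \<omega>) (r / p) \<partial>P)"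
  proof (rule nn_integral_mono)
    fix \<omega> assume w: "\<omega> \<in> space P"
    show "ennreal (norm (path_dist (\<lambda>_. 0) \<omega> powr r)) \<le> epowr (path_energy \<omega>) (r / p)"
    proof (cases "path_energy \<omega> = \<infinity>")
      case False
      have "Lp_energy M p (\<lambda>t. X t \<omega>) = enn2real (path_energy \<omega>)"
        unfolding Lp_energy_def path_energy_def using path_measurable[OF w]
        by (intro integral_eq_nn_integral) (auto simp: sum_nonneg)
      then show ?thesis
        using False by (simp add: path_dist_def Lp_norm_eq_energy[OF p_pos] epowr_def powr_powr)
    qed (simp add: epowr_def)
  qed
  then show "(\<integral>\<^sup>+\<omega>. ennreal (norm (path_dist (\<lambda>_. 0) \<omega> powr r)) \<partial>P) < \<infinity>"
    using path_energy_moment by (rule le_less_trans)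
qed

lemma path_dist_moment:
  assumes g: "g \<in> Lp_space M p"
  shows "integrable P (\<lambda>\<omega>. path_dist g \<omega> powr (r - 1))"
proof (rule Bochner_Integration.integrable_bound)
  define c where "c = Lp_norm M p g"
  note [measurable] = path_dist_measurable[OF g]
  show "integrable P (\<lambda>\<omega>. 1 + 2 powr r * (path_dist (\<lambda>_. 0) \<omega> powr r + c powr r))"
    using path_norm_moment by simp
  show "AE \<omega> in P. norm (path_dist g \<omega> powr (r - 1)) \<le> norm (1 + 2 powr r * (path_dist (\<lambda>_. 0) \<omega> powr r + c powr r))"
    using AE_path_in_Lp
  proof eventually_elim
    case (elim \<omega>)
    define u v where "u = path_dist g \<omega>" and "v = path_dist (\<lambda>_. 0) \<omega>"
    have nn: "u \<ge> 0" "v \<ge> 0" "c \<ge> 0" by (simp_all add: u_def v_def c_def path_dist_def Lp_norm_nonneg)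
    have zero: "(\<lambda>_. 0) \<in> Lp_space M p" by (simp add: Lp_space_iff[OF p_pos])
    have "u \<le> v + c"
      using Lp_norm_dist_triangle[OF p_ge_1 elim zero g] Lp_norm_minus[of M p g]
      by (simp add: u_def v_def c_def path_dist_def)
    then have "u \<le> 2 * max v c" by simp
    then have "u powr r \<le> (2 * max v c) powr r" using nn r_pos by (intro powr_mono2) auto
    also have "\<dots> = 2 powr r * max v c powr r" by (simp add: powr_mult)
    also have "\<dots> \<le> 2 powr r * (v powr r + c powr r)" by (intro mult_left_mono) (auto simp: max_def)
    finally have "u powr r \<le> 2 powr r * (v powr r + c powr r)" .
    moreover have "u powr (r - 1) \<le> 1 + u powr r"
    proof (cases "u \<le> 1")
      case True
      then have "u powr (r - 1) \<le> 1" using nn p_ge_1 p_le_r by (simp add: powr_le1)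
      then show ?thesis by (smt (verit) powr_ge_zero)
    next
      case False
      then have "u powr (r - 1) \<le> u powr r" by (intro powr_mono) auto
      then show ?thesis by simp
    qed
    ultimately show ?case by (simp add: u_def v_def)
  qed
qed (use path_dist_measurable[OF g] in auto)

lemma strict_cell_partition:
  assumes i: "i \<in> {1..n}"
  obtains C where "voronoi_partition M p n a C" and "C i = strict_cell M p n a i"
  using voronoi_partition_strict_cell[where M = M and p = p and n = n and a = a and i = i] p_ge_1 a_Lp i that
  by blast

text \<open>Stationarity supplies measurability of the event as well, because a set outside the sigma algebra
  has measure \<open>0\<close> by convention.\<close>

lemma cell_event:
  assumes i: "i \<in> {1..n}"
  shows "\<P>(\<omega> in P. (\<lambda>t. X t \<omega>) \<in> strict_cell M p n a i) > 0"
    and "{\<omega> \<in> space P. (\<lambda>t. X t \<omega>) \<in> strict_cell M p n a i} \<in> sets P"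
proof -
  obtain C where C: "voronoi_partition M p n a C" "C i = strict_cell M p n a i"
    by (rule strict_cell_partition[OF i])
  show pos: "\<P>(\<omega> in P. (\<lambda>t. X t \<omega>) \<in> strict_cell M p n a i) > 0"
  proof -
    have "\<P>(\<omega> in P. (\<lambda>t. X t \<omega>) \<in> C i) > 0"
      using stationary C(1) i unfolding stationary_quantizer_def by blast
    then show ?thesis by (simp only: C(2))
  qed
  show "{\<omega> \<in> space P. (\<lambda>t. X t \<omega>) \<in> strict_cell M p n a i} \<in> sets P"
    using pos measure_notin_sets by force
qed

lemma cell_weight_measurable: 
  assumes i: "i \<in> {1..n}"
  shows "cell_weight i \<in> borel_measurable P"
proof -
  define A where "A = {\<omega> \<in> space P. (\<lambda>t. X t \<omega>) \<in> strict_cell M p n a i}"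
  have [measurable]: "A \<in> sets P" unfolding A_def by (rule cell_event[OF i])
  note [measurable] = path_dist_measurable[OF a_Lp[OF i]]
  have "(\<lambda>\<omega>. indicator A \<omega> * (if r = p then 1 else path_dist (a i) \<omega> powr (r - p))) \<in> borel_measurable P"
    by measurable
  then show ?thesis
    by (rule measurable_cong[THEN iffD1, rotated]) (simp add: cell_weight_def A_def indicator_def)
qed

lemma cell_weight_nonneg: "cell_weight i \<omega> \<ge> 0"
  by (simp add: cell_weight_def)

lemma cell_weight_bound:
  assumes c: "0 < c" and z: "0 \<le> z"
  shows "cell_weight i \<omega> * z powr (p - 1) \<le>
    c powr (p - 1) * path_dist (a i) \<omega> powr (r - 1) + c powr (p - r) * z powr (r - 1)"
proof -
  define N where "N = path_dist (a i) \<omega>"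
  have N: "N \<ge> 0" by (simp add: N_def path_dist_def Lp_norm_nonneg)
  have "cell_weight i \<omega> \<le> (if r = p then 1 else N powr (r - p))"
    by (simp add: cell_weight_def N_def indicator_def)
  then have "cell_weight i \<omega> * z powr (p - 1) \<le> (if r = p then 1 else N powr (r - p)) * z powr (p - 1)"
    by (intro mult_right_mono) auto
  also have "\<dots> \<le> c powr (p - 1) * N powr (r - 1) + c powr (p - r) * z powr (r - 1)"
  proof (cases "r = p")
    case True
    then show ?thesis using c N by simp
  next
    case rp: False
    show ?thesis
    \<comment> \<open>The larger of \<open>z\<close> and \<open>c * N\<close> absorbs the other factor.\<close>
    proof (cases "z \<le> c * N")
      case True
      have "N powr (r - p) * z powr (p - 1) \<le> N powr (r - p) * (c * N) powr (p - 1)"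
        using True z p_ge_1 by (intro mult_left_mono powr_mono2) auto
      also have "\<dots> = c powr (p - 1) * (N powr (r - p) * N powr (p - 1))"
        by (simp add: powr_mult)
      also have "N powr (r - p) * N powr (p - 1) = N powr (r - 1)"
        by (simp add: powr_add[symmetric])
      finally show ?thesis using rp by (simp add: add_increasing2)
    next
      case False
      then have "N powr (r - p) \<le> (z / c) powr (r - p)"
        using N c p_le_r by (intro powr_mono2) (auto simp: field_simps)
      then have "N powr (r - p) * z powr (p - 1) \<le> (z / c) powr (r - p) * z powr (p - 1)"
        by (intro mult_right_mono) auto
      also have "\<dots> = c powr (p - r) * (z powr (r - p) * z powr (p - 1))"
      proof -
        have "(z / c) powr (r - p) = z powr (r - p) / c powr (r - p)"
          by (rule powr_divide)
        moreover have "c powr (p - r) = 1 / c powr (r - p)"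
          using powr_minus_divide[of c "r - p"] by simp
        ultimately show ?thesis by simp
      qed
      also have "z powr (r - p) * z powr (p - 1) = z powr (r - 1)"
        by (simp add: powr_add[symmetric])
      finally show ?thesis using rp by (simp add: add_increasing)
    qed
  qed
  finally show ?thesis by (simp add: N_def)
qed

text \<open>The probability of this event in the definition of the index set is thus a genuine probability,
  and its vanishing says that the event is null.\<close>

lemma path_eq_event:
  assumes [measurable]: "g \<in> borel_measurable M"
  shows "{\<omega> \<in> space P. AE t in M. X t \<omega> = g t} \<in> sets P"
proof -
  have "{\<omega> \<in> space P. AE t in M. X t \<omega> = g t} =
    {\<omega> \<in> space P. (\<integral>\<^sup>+t. indicator {x \<in> space (P \<Otimes>\<^sub>M M). X (snd x) (fst x) \<noteq> g (snd x)} (\<omega>, t) \<partial>M) = 0}"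
  proof (rule Collect_cong, rule conj_cong[OF refl])
    fix \<omega> assume w: "\<omega> \<in> space P"
    note [measurable] = path_measurable[OF w] w
    show "(AE t in M. X t \<omega> = g t) \<longleftrightarrow>
      (\<integral>\<^sup>+t. indicator {x \<in> space (P \<Otimes>\<^sub>M M). X (snd x) (fst x) \<noteq> g (snd x)} (\<omega>, t) \<partial>M) = 0"
      by (subst nn_integral_0_iff_AE) (auto simp: indicator_def space_pair_measure w intro!: AE_cong)
  qed
  also have "\<dots> \<in> sets P" by measurable
  finally show ?thesis .
qed

text \<open>For \<open>r > p\<close> the weight vanishes on a path in the cell only if the path is equal to \<open>a i\<close> almost
  everywhere; this is what the index set excludes.\<close>

lemma cell_weight_pos:
  assumes i: "i \<in> index_set P M p r X n a"
  shows "AE \<omega> in P. (\<lambda>t. X t \<omega>) \<in> strict_cell M p n a i \<longrightarrow> cell_weight i \<omega> > 0"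
proof (cases "r = p")
  case True
  show ?thesis unfolding cell_weight_def using True by simp
next
  case False
  have i': "i \<in> {1..n}" using i by (auto simp: index_set_def split: if_splits)
  have "\<P>(\<omega> in P. AE t in M. X t \<omega> = a i t) = 0"
    using False i p_le_r by (auto simp: index_set_def split: if_splits)
  then have "AE \<omega> in P. \<not> (AE t in M. X t \<omega> = a i t)"
    using path_eq_event[OF Lp_measurable[OF a_Lp[OF i']]]
    by (subst (asm) prob_eq_0) auto
  then show ?thesis
  proof eventually_elim
    case (elim \<omega>)
    show ?case
    proof
      assume cell: "(\<lambda>t. X t \<omega>) \<in> strict_cell M p n a i"
      have "path_dist (a i) \<omega> \<noteq> 0"
        using Lp_norm_eq_0_iff[OF p_pos Lp_space_diff[OF p_ge_1 _ a_Lp[OF i']], of "\<lambda>t. X t \<omega>"] cell elim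
        by (auto simp: path_dist_def strict_cell_def)
      then show "cell_weight i \<omega> > 0" using cell by (simp add: cell_weight_def)
    qed
  qed
qed

lemma cell_weight_nonzero:
  assumes i: "i \<in> index_set P M p r X n a"
  shows "\<not> (AE \<omega> in P. cell_weight i \<omega> = 0)"
proof
  assume zero: "AE \<omega> in P. cell_weight i \<omega> = 0"
  have i': "i \<in> {1..n}" using i by (auto simp: index_set_def split: if_splits)
  have "AE \<omega> in P. (\<lambda>t. X t \<omega>) \<notin> strict_cell M p n a i"
    using zero cell_weight_pos[OF i] by eventually_elim auto
  then have "\<P>(\<omega> in P. (\<lambda>t. X t \<omega>) \<in> strict_cell M p n a i) = 0"
    using cell_event(2)[OF i'] by (subst prob_eq_0) auto
  then show False using cell_event(1)[OF i'] by simp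
qed

lemma component_moment:
  assumes t: "t \<in> space M"
  shows "integrable P (\<lambda>\<omega>. \<bar>X t \<omega> $ j\<bar> powr (r - 1))"
proof (cases "r = 1")
  case True
  show ?thesis
    by (rule integrable_const_bound[of _ 1]) (use t in \<open>auto simp: True\<close>)
next
  case False
  then have r1: "r - 1 > 0" using p_ge_1 p_le_r by simp
  show ?thesis
  proof (rule Bochner_Integration.integrable_bound)
    show "integrable P (\<lambda>\<omega>. \<Sum>j\<in>UNIV. \<bar>X t \<omega> $ j\<bar> powr (r - 1))"
      using random_vector[OF t] r1 by (simp add: Lq_random_vector_def ell_norm_powr)
    have "\<bar>X t \<omega> $ j\<bar> powr (r - 1) \<le> (\<Sum>j\<in>UNIV. \<bar>X t \<omega> $ j\<bar> powr (r - 1))" for \<omega>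
      by (rule member_le_sum) auto
    then show "AE \<omega> in P. norm (\<bar>X t \<omega> $ j\<bar> powr (r - 1)) \<le> norm (\<Sum>j\<in>UNIV. \<bar>X t \<omega> $ j\<bar> powr (r - 1))"
      by (auto intro: order_trans[OF _ abs_ge_self])
  qed (use t in measurable)
qed

lemma cell_process:
  assumes i: "i \<in> index_set P M p r X n a"
  shows "weighted_process P M (\<lambda>t \<omega>. X t \<omega> $ j) (cell_weight i) (path_dist (a i)) p r"
proof -
  have i': "i \<in> {1..n}" using i by (auto simp: index_set_def split: if_splits)
  show ?thesis
  proof unfold_locales
    have "(\<lambda>x. X (fst x) (snd x)) \<in> borel_measurable (M \<Otimes>\<^sub>M P)"
      using measurable_pair_swap[OF X_joint] by (simp add: case_prod_beta')
    then show "(\<lambda>(t, \<omega>). X t \<omega> $ j) \<in> borel_measurable (M \<Otimes>\<^sub>M P)"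
      by (simp add: case_prod_beta')
  qed (use p_ge_1 p_le_r component_moment cell_weight_measurable[OF i'] cell_weight_nonneg
      path_dist_moment[OF a_Lp[OF i']] cell_weight_bound cell_weight_nonzero[OF i] in auto)
qed

abbreviation cell_balance :: "nat \<Rightarrow> 'd \<Rightarrow> 't \<Rightarrow> real \<Rightarrow> real" where
  "cell_balance i j \<equiv> weighted_process.balance P (\<lambda>t \<omega>. X t \<omega> $ j) (cell_weight i) p"

lemma quantizer_balance_zero:
  assumes i: "i \<in> index_set P M p r X n a"
  shows "AE t in M. cell_balance i j t (a i t $ j) = 0"
proof -
  have i': "i \<in> {1..n}" using i by (auto simp: index_set_def split: if_splits)
  obtain C where C: "voronoi_partition M p n a C" "C i = strict_cell M p n a i"
    by (rule strict_cell_partition[OF i'])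
  have "AE t in M. has_bochner_integral P
    (\<lambda>\<omega>. indicator (C i) (\<lambda>s. X s \<omega>) * (if r = p then 1 else Lp_norm M p (\<lambda>s. X s \<omega> - a i s) powr (r - p)) *
       \<bar>a i t $ j - X t \<omega> $ j\<bar> powr (p - 1) * sgn (a i t $ j - X t \<omega> $ j)) 0"
    using stationary C(1) i' unfolding stationary_quantizer_def by blast
  then show ?thesis
  proof eventually_elim
    case (elim t)
    have "cell_balance i j t (a i t $ j) = (LINT \<omega>|P. indicator (C i) (\<lambda>s. X s \<omega>) *
      (if r = p then 1 else Lp_norm M p (\<lambda>s. X s \<omega> - a i s) powr (r - p)) *
       \<bar>a i t $ j - X t \<omega> $ j\<bar> powr (p - 1) * sgn (a i t $ j - X t \<omega> $ j))"
      unfolding weighted_process.balance_def[OF cell_process[OF i]] C(2) cell_weight_def path_dist_def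
        signed_powr_def by (simp only: mult.assoc)
    then show ?case using has_bochner_integral_integral_eq[OF elim] by simp
  qed
qed

text \<open>By stationarity \<open>a i t\<close> is a root of the balance for almost every \<open>t\<close>, and the sign change is the
  only possible root. Measurability of \<open>b\<close> is not inherited from \<open>a i\<close> across the exceptional set; it
  comes from the joint measurability of the process.\<close>

lemma sign_change_version:
  assumes i: "i \<in> index_set P M p r X n a"
    and b: "\<And>t j. t \<in> space M \<Longrightarrow> changes_sign_at (cell_balance i j t) (b t $ j)"
  shows "Lp_version M p (a i) b"
proof -
  have i': "i \<in> {1..n}" using i by (auto simp: index_set_def split: if_splits)
  have "(\<lambda>t. b t $ j) \<in> borel_measurable M" for j
    by (rule sign_change_measurable[OF b weighted_process.balance_measurable[OF cell_process[OF i]]])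
  then have meas [measurable]: "b \<in> borel_measurable M" by (rule vec_measurableI)
  note [measurable] = Lp_measurable[OF a_Lp[OF i']]
  have "AE t in M. \<forall>j\<in>UNIV. cell_balance i j t (a i t $ j) = 0"
    using quantizer_balance_zero[OF i] by (intro AE_finite_allI) auto
  then have eq: "AE t in M. b t = a i t"
    using AE_space
  proof eventually_elim
    case (elim t)
    have "a i t $ j = b t $ j" for j
      using elim(1) by (intro changes_sign_at_root[OF b[OF elim(2)]]) simp
    then show ?case by (simp add: vec_eq_iff)
  qed
  have "integrable M (\<lambda>t. \<Sum>j\<in>UNIV. \<bar>a i t $ j\<bar> powr p)"
    using a_Lp[OF i'] by (simp add: Lp_space_iff[OF p_pos])
  moreover have "AE t in M. (\<Sum>j\<in>UNIV. \<bar>a i t $ j\<bar> powr p) = (\<Sum>j\<in>UNIV. \<bar>b t $ j\<bar> powr p)"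
    using eq by eventually_elim simp
  ultimately have "integrable M (\<lambda>t. \<Sum>j\<in>UNIV. \<bar>b t $ j\<bar> powr p)"
    by (subst integrable_cong_AE[symmetric]) auto
  then have "b \<in> Lp_space M p" by (simp add: Lp_space_iff[OF p_pos])
  with eq show ?thesis by (simp add: Lp_version_def)
qed

lemma sign_change_vector:
  assumes i: "i \<in> index_set P M p r X n a"
    and ex: "\<And>t j. t \<in> space M \<Longrightarrow> \<exists>c. changes_sign_at (cell_balance i j t) c"
  shows "\<exists>b. \<forall>t\<in>space M. \<forall>j. changes_sign_at (cell_balance i j t) (b t $ j)"
proof (intro exI ballI allI)
  fix t j assume "t \<in> space M"
  then show "changes_sign_at (cell_balance i j t) ((\<chi> j. SOME c. changes_sign_at (cell_balance i j t) c) $ j)"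
    using someI_ex[OF ex] by simp
qed

text \<open>The prescribed value needs no modification of \<open>b\<close>: it is itself the sign change.\<close>

lemma sign_change_at_deterministic:
  assumes i: "i \<in> index_set P M p r X n a"
    and b: "\<And>t j. t \<in> space M \<Longrightarrow> changes_sign_at (cell_balance i j t) (b t $ j)"
    and t: "t \<in> space M" and X: "AE \<omega> in P. X t \<omega> = x"
  shows "b t = x"
proof (subst vec_eq_iff, rule allI)
  fix j
  have "AE \<omega> in P. X t \<omega> $ j = x $ j" using X by eventually_elim simp
  then have "changes_sign_at (cell_balance i j t) (x $ j)"
    by (rule weighted_process.balance_changes_sign_const[OF cell_process[OF i] t])
  then show "b t $ j = x $ j" using changes_sign_at_unique[OF b[OF t]] by blast
qed

subsection \<open>Strictly convex norms\<close>

lemma strictly_convex_sign_change: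
  assumes p: "p > 1" and i: "i \<in> index_set P M p r X n a"
  shows "\<exists>b. \<forall>t\<in>space M. \<forall>j. changes_sign_at (cell_balance i j t) (b t $ j)"
proof (rule sign_change_vector[OF i])
  show "\<exists>c. changes_sign_at (cell_balance i j t) c" if t: "t \<in> space M" for t j
    by (rule weighted_process.balance_changes_sign[OF cell_process[OF i] t
        weighted_process.balance_strict_mono[OF cell_process[OF i] t p]])
qed

lemma component_gap_le:
  assumes i: "i \<in> index_set P M p r X n a" and r: "r > 1" and s: "s \<in> space M" and t: "t \<in> space M"
  shows "weighted_process.moment_gap P (\<lambda>t \<omega>. X t \<omega> $ j) r s t \<le>
    intrinsic_semimetric P X (r - 1) s t powr (max (r - 1) 1)"
proof -
  note int = weighted_process.gap_integrable[OF cell_process[OF i] s t]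
  have "weighted_process.moment_gap P (\<lambda>t \<omega>. X t \<omega> $ j) r s t
    \<le> (LINT \<omega>|P. (\<Sum>k\<in>UNIV. \<bar>X s \<omega> $ k - X t \<omega> $ k\<bar> powr (r - 1)))"
    unfolding weighted_process.moment_gap_def[OF cell_process[OF i]] using int
    by (intro integral_mono member_le_sum[where f = "\<lambda>k. \<bar>X s _ $ k - X t _ $ k\<bar> powr (r - 1)"] Bochner_Integration.integrable_sum) auto
  also have "\<dots> = (LINT \<omega>|P. ell_norm (r - 1) (X s \<omega> - X t \<omega>) powr (r - 1))"
    using r by (simp add: ell_norm_powr)
  also have "\<dots> = intrinsic_semimetric P X (r - 1) s t powr (max (r - 1) 1)"
    unfolding intrinsic_semimetric_def by (simp add: powr_powr)
  finally show ?thesis .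
qed

lemma sign_change_semimetric_continuous:
  assumes p: "p > 1" and i: "i \<in> index_set P M p r X n a"
    and b: "\<And>t j. t \<in> space M \<Longrightarrow> changes_sign_at (cell_balance i j t) (b t $ j)"
  shows "semimetric_continuous_on (space M) (intrinsic_semimetric P X (r - 1)) b"
  unfolding semimetric_continuous_on_def
proof (intro ballI allI impI)
  fix s and e :: real assume s: "s \<in> space M" and e: "e > 0"
  define e' where "e' = e / (2 * real CARD('d))"
  have e': "e' > 0" "real CARD('d) * e' < e" using e by (auto simp: e'_def)
  have r: "r > 1" using p p_le_r by simp
  have "\<exists>\<delta>>0. \<forall>t\<in>space M. weighted_process.moment_gap P (\<lambda>t \<omega>. X t \<omega> $ j) r s t < \<delta> \<longrightarrow> \<bar>b s $ j - b t $ j\<bar> < e'" for j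
    using weighted_process.sign_change_continuous[OF cell_process[OF i] p b s e'(1)] by blast
  then obtain \<delta> where \<delta>: "\<And>j. \<delta> j > 0"
    "\<And>j t. t \<in> space M \<Longrightarrow> weighted_process.moment_gap P (\<lambda>t \<omega>. X t \<omega> $ j) r s t < \<delta> j \<Longrightarrow> \<bar>b s $ j - b t $ j\<bar> < e'"
    by metis
  define D where "D = Min (range \<delta>)"
  have D: "D > 0" "\<And>j. D \<le> \<delta> j" using \<delta>(1) by (auto simp: D_def)
  define m where "m = max (r - 1) 1"
  have m: "m > 0" by (simp add: m_def)
  show "\<exists>\<delta>>0. \<forall>t\<in>space M. intrinsic_semimetric P X (r - 1) s t < \<delta> \<longrightarrow> norm (b s - b t) < e"
  proof (intro exI[of _ "D powr (1 / m)"] conjI ballI impI)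
    fix t assume t: "t \<in> space M" and near: "intrinsic_semimetric P X (r - 1) s t < D powr (1 / m)"
    have "intrinsic_semimetric P X (r - 1) s t powr m < (D powr (1 / m)) powr m"
      using near m by (intro powr_less_mono2) (auto simp: intrinsic_semimetric_def)
    then have "intrinsic_semimetric P X (r - 1) s t powr m < D" using D m by (simp add: powr_powr)
    then have "\<bar>b s $ j - b t $ j\<bar> \<le> e'" for j
      using component_gap_le[OF i r s t, of j] D(2)[of j] by (intro less_imp_le \<delta>(2)[OF t]) (simp add: m_def)
    then show "norm (b s - b t) < e" using norm_diff_le_card_mult e'(2) by (meson le_less_trans)
  qed (use D in simp)
qed

lemma sign_change_semimetric_lipschitz:
  assumes p: "p = 2" and i: "i \<in> index_set P M p r X n a"
    and b: "\<And>t j. t \<in> space M \<Longrightarrow> changes_sign_at (cell_balance i j t) (b t $ j)"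
  shows "semimetric_lipschitz_on (space M) (intrinsic_semimetric P X (r - 1)) b"
proof -
  have r: "r \<ge> 2" using p p_le_r by simp
  have "\<exists>L\<ge>0. \<forall>s\<in>space M. \<forall>t\<in>space M.
    \<bar>b s $ j - b t $ j\<bar> \<le> L * weighted_process.moment_gap P (\<lambda>t \<omega>. X t \<omega> $ j) r s t powr (1 / (r - 1))" for j
    using weighted_process.sign_change_lipschitz[OF cell_process[OF i] p b] by blast
  then obtain L where L: "\<And>j. L j \<ge> 0" "\<And>j s t. s \<in> space M \<Longrightarrow> t \<in> space M \<Longrightarrow>
    \<bar>b s $ j - b t $ j\<bar> \<le> L j * weighted_process.moment_gap P (\<lambda>t \<omega>. X t \<omega> $ j) r s t powr (1 / (r - 1))"
    by metis
  define K where "K = Max (range L)"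
  have K: "\<And>j. L j \<le> K" by (auto simp: K_def)
  then have K0: "K \<ge> 0" using L(1) order_trans by blast
  show ?thesis
    unfolding semimetric_lipschitz_on_def
  proof (intro exI[of _ "real CARD('d) * K"] conjI ballI)
    fix s t assume s: "s \<in> space M" and t: "t \<in> space M"
    define \<rho> where "\<rho> = intrinsic_semimetric P X (r - 1) s t"
    have rho: "\<rho> \<ge> 0" by (simp add: \<rho>_def intrinsic_semimetric_def)
    have "\<bar>b s $ j - b t $ j\<bar> \<le> K * \<rho>" for j
    proof -
      define g where "g = weighted_process.moment_gap P (\<lambda>t \<omega>. X t \<omega> $ j) r s t"
      have "g \<ge> 0" by (simp add: g_def weighted_process.moment_gap_def[OF cell_process[OF i]])
      moreover have "max (r - 1) 1 = r - 1" using r by simp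
      then have "g \<le> \<rho> powr (r - 1)"
        using component_gap_le[OF i _ s t, of j] r by (simp add: g_def \<rho>_def)
      ultimately have "g powr (1 / (r - 1)) \<le> (\<rho> powr (r - 1)) powr (1 / (r - 1))"
        using r by (intro powr_mono2) auto
      also have "\<dots> = \<rho>" using r rho by (simp add: powr_powr)
      finally have "L j * g powr (1 / (r - 1)) \<le> K * \<rho>"
        using K L(1) K0 by (intro mult_mono) auto
      then show ?thesis using L(2)[OF s t, of j] by (simp add: g_def)
    qed
    then have "norm (b s - b t) \<le> real CARD('d) * (K * \<rho>)" by (rule norm_diff_le_card_mult)
    then show "norm (b s - b t) \<le> real CARD('d) * K * intrinsic_semimetric P X (r - 1) s t"
      by (simp add: \<rho>_def mult.assoc)
  qed (use K0 in simp)
qed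

end

section \<open>Continuous functions on a compact metric space\<close>

lemma continuous_map_sequentiallyI:
  fixes f :: "'t \<Rightarrow> 'b::topological_space"
  assumes "\<And>s \<sigma>. s \<in> mspace m \<Longrightarrow> range \<sigma> \<subseteq> mspace m \<Longrightarrow>
    limitin (mtopology_of m) \<sigma> s sequentially \<Longrightarrow> (\<lambda>k. f (\<sigma> k)) \<longlonglongrightarrow> f s"
  shows "continuous_map (mtopology_of m) euclidean f"
proof -
  interpret Metric_space "mspace m" "mdist m" by (rule Metric_space_mspace_mdist)
  have "(f \<longlongrightarrow> f s) (atin mtopology s)" if s: "s \<in> mspace m" for s
    unfolding tendsto_def eventually_atin_sequentially
    using assms[OF s] unfolding tendsto_def mtopology_of_def by blast
  then show ?thesis by (simp add: continuous_map_atin mtopology_of_def)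
qed

lemma continuous_functionsI_sequentially:
  assumes "\<And>s \<sigma>. s \<in> mspace m \<Longrightarrow> range \<sigma> \<subseteq> mspace m \<Longrightarrow>
    limitin (mtopology_of m) \<sigma> s sequentially \<Longrightarrow> (\<lambda>k. f (\<sigma> k)) \<longlonglongrightarrow> f s"
  shows "f \<in> continuous_functions m"
  unfolding continuous_functions_def using continuous_map_sequentiallyI[of m f] assms by simp

lemma continuous_functions_sequentially:
  assumes "f \<in> continuous_functions m" and "limitin (mtopology_of m) \<sigma> s sequentially"
  shows "(\<lambda>k. f (\<sigma> k)) \<longlonglongrightarrow> f s"
  using continuous_map_limit[of "mtopology_of m" euclidean f \<sigma> s sequentially] assms
  by (simp add: continuous_functions_def o_def)

text \<open>The distance to a nonempty closed set vanishes exactly on that set.\<close>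

lemma closed_zero_set:
  assumes S: "closedin (mtopology_of m) S"
  obtains g :: "'t \<Rightarrow> real" where "continuous_map (mtopology_of m) euclidean g"
    and "\<And>t. t \<in> mspace m \<Longrightarrow> g t \<ge> 0" and "\<And>t. t \<in> mspace m \<Longrightarrow> g t = 0 \<longleftrightarrow> t \<in> S"
proof (cases "S = {}")
  case True
  show ?thesis by (rule that[of "\<lambda>_. 1"]) (use True in auto)
next
  case ne: False
  interpret Metric_space "mspace m" "mdist m" by (rule Metric_space_mspace_mdist)
  have sub: "S \<subseteq> mspace m" using closedin_subset[OF S] by simp
  define g where "g t = (INF s\<in>S. mdist m t s)" for t
  have bdd: "bdd_below ((\<lambda>s. mdist m t s) ` S)" for t by (rule bdd_belowI[of _ 0]) auto
  have le: "g u \<le> mdist m u t + g t" if u: "u \<in> mspace m" and t: "t \<in> mspace m" for u t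
  proof -
    have "g u - mdist m u t \<le> g t"
      unfolding g_def[of t]
    proof (rule cINF_greatest[OF ne])
      fix s assume s: "s \<in> S"
      have "g u \<le> mdist m u s" unfolding g_def by (rule cINF_lower[OF bdd s])
      also have "\<dots> \<le> mdist m u t + mdist m t s" using s sub u t by (intro triangle) auto
      finally show "g u - mdist m u t \<le> mdist m t s" by simp
    qed
    then show ?thesis by simp
  qed
  have "Lipschitz_continuous_map m euclidean_metric g"
    unfolding Lipschitz_continuous_map_def
  proof (intro conjI exI[of _ 1] ballI)
    fix u t assume "u \<in> mspace m" "t \<in> mspace m"
    then show "mdist euclidean_metric (g u) (g t) \<le> 1 * mdist m u t"
      using le[of u t] le[of t u] by (simp add: dist_real_def abs_le_iff commute)
  qed auto
  then have "continuous_map (mtopology_of m) euclidean g"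
    using Lipschitz_continuous_imp_continuous_map by force
  moreover have nn: "g t \<ge> 0" for t unfolding g_def using ne by (intro cINF_greatest) auto
  moreover have "g t = 0 \<longleftrightarrow> t \<in> S" if t: "t \<in> mspace m" for t
  proof
    assume "t \<in> S"
    then have "g t \<le> mdist m t t" unfolding g_def by (rule cINF_lower[OF bdd])
    then show "g t = 0" using nn[of t] t by simp
  next
    assume 0: "g t = 0"
    show "t \<in> S"
    proof (rule ccontr)
      assume "t \<notin> S"
      then obtain e where e: "e > 0" "disjnt S (mball t e)"
        using S t unfolding mtopology_of_def closedin_metric by blast
      have "e \<le> g t" unfolding g_def
      proof (rule cINF_greatest[OF ne])
        fix s assume "s \<in> S"
        then have "s \<notin> mball t e" "s \<in> mspace m" using e sub by (auto simp: disjnt_iff)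
        then show "e \<le> mdist m t s" using t by auto
      qed
      then show False using 0 e by simp
    qed
  qed
  ultimately show ?thesis using that by blast
qed

lemma finite_nets:
  assumes "compact_space (mtopology_of m)"
  obtains K :: "nat \<Rightarrow> 't set" where "\<And>k. finite (K k)" and "\<And>k. K k \<subseteq> mspace m"
    and "\<And>k t. t \<in> mspace m \<Longrightarrow> \<exists>c\<in>K k. mdist m c t < inverse (Suc k)"
proof -
  interpret Metric_space "mspace m" "mdist m" by (rule Metric_space_mspace_mdist)
  have "mtotally_bounded (mspace m)"
    using assms compact_space_eq_mcomplete_mtotally_bounded by (simp add: mtopology_of_def)
  then have "\<exists>K. finite K \<and> K \<subseteq> mspace m \<and> mspace m \<subseteq> (\<Union>x\<in>K. mball x (inverse (real (Suc k))))" for k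
    unfolding mtotally_bounded_def by (simp del: of_nat_Suc)
  then obtain K where K: "\<And>k. finite (K k)" "\<And>k. K k \<subseteq> mspace m"
    "\<And>k. mspace m \<subseteq> (\<Union>x\<in>K k. mball x (inverse (real (Suc k))))" by metis
  show ?thesis
  proof (rule that[of K])
    show "\<exists>c\<in>K k. mdist m c t < inverse (Suc k)" if "t \<in> mspace m" for t k
      using K(3)[of k] that by (force simp del: of_nat_Suc)
  qed (use K in auto)
qed

text \<open>Points \<open>c k\<close> of the nets \<open>K k\<close> at distance below \<open>1 / (k + 1)\<close> from \<open>t\<close> converge to \<open>t\<close>.\<close>

lemma continuous_le_dense:
  fixes \<phi> :: "'t \<Rightarrow> real"
  assumes K: "\<And>k t. t \<in> mspace m \<Longrightarrow> \<exists>c\<in>K k. mdist m c t < inverse (Suc k)" and sub: "\<And>k. K k \<subseteq> mspace m"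
    and \<phi>: "continuous_map (mtopology_of m) euclidean \<phi>"
    and le: "\<And>c. c \<in> (\<Union>k. K k) \<Longrightarrow> \<phi> c \<le> q" and t: "t \<in> mspace m"
  shows "\<phi> t \<le> q"
proof -
  interpret Metric_space "mspace m" "mdist m" by (rule Metric_space_mspace_mdist)
  have "\<exists>c\<in>K k. mdist m c t < inverse (Suc k)" for k by (rule K[OF t])
  then obtain c where c: "\<And>k. c k \<in> K k" "\<And>k. mdist m (c k) t < inverse (Suc k)" by metis
  have "(\<lambda>k. mdist m (c k) t) \<longlonglongrightarrow> 0"
    by (rule tendsto_sandwich[OF _ _ tendsto_const LIMSEQ_inverse_real_of_nat])
       (use c(2) in \<open>auto intro!: always_eventually less_imp_le\<close>)
  then have "limitin (mtopology_of m) c t sequentially"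
    unfolding mtopology_of_def limitin_metric_dist_null using t c(1) sub by (auto intro!: always_eventually)
  then have "(\<lambda>k. \<phi> (c k)) \<longlonglongrightarrow> \<phi> t"
    using continuous_map_limit[OF \<phi>, of c t sequentially] by (simp add: o_def)
  then show ?thesis by (rule LIMSEQ_le_const2) (use le c in auto)
qed

text \<open>Separability of the space of continuous functions, in the form of arbitrarily small sets from a
  countable family. A set of the family prescribes, up to an error, values from a countable dense set
  around the points of a finite net; uniform continuity puts every continuous function into such sets.\<close>

lemma continuous_functions_countable_cover:
  fixes m :: "'t metric"
  assumes comp: "compact_space (mtopology_of m)"
  obtains \<U> :: "('t \<Rightarrow> real ^ 'd) set set" where "countable \<U>"
    and "\<And>f e. f \<in> continuous_functions m \<Longrightarrow> e > 0 \<Longrightarrow>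
      \<exists>U\<in>\<U>. f \<in> U \<and> (\<forall>g\<in>U. \<forall>t\<in>mspace m. norm (f t - g t) < e)"
proof -
  obtain K where K: "\<And>k. finite (K k)" "\<And>k. K k \<subseteq> mspace m"
    "\<And>k t. t \<in> mspace m \<Longrightarrow> \<exists>c\<in>K k. mdist m c t < inverse (Suc k)"
    by (rule finite_nets[OF comp]) blast
  obtain D :: "(real ^ 'd) set" where D: "countable D" "\<And>x e. e > 0 \<Longrightarrow> \<exists>d\<in>D. dist d x < e"
  proof -
    obtain D :: "(real ^ 'd) set" where D: "countable D" "\<And>X. open X \<Longrightarrow> X \<noteq> {} \<Longrightarrow> \<exists>d\<in>D. d \<in> X"
      by (rule countable_dense_setE) blast
    have "\<exists>d\<in>D. dist d x < e" if "e > 0" for x :: "real ^ 'd" and e :: real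
      using D(2)[of "ball x e"] that by (auto simp: dist_commute)
    then show ?thesis using that D(1) by blast
  qed
  define V where "V k l h = {g. \<forall>c\<in>K k. \<forall>t\<in>mspace m. mdist m c t < inverse (Suc k) \<longrightarrow>
    norm (g t - h c) < inverse (Suc l)}" for k l :: nat and h :: "'t \<Rightarrow> real ^ 'd"
  define \<U> where "\<U> = (\<Union>k. \<Union>l. V k l ` (PiE (K k) (\<lambda>_. D)))"
  have "countable \<U>"
    unfolding \<U>_def using K(1) D(1) by (intro countable_UN countable_image countable_PiE) auto
  moreover have "\<exists>U\<in>\<U>. f \<in> U \<and> (\<forall>g\<in>U. \<forall>t\<in>mspace m. norm (f t - g t) < e)"
    if f: "f \<in> continuous_functions m" and e: "e > 0" for f e
  proof -
    obtain l where l: "inverse (real (Suc l)) < e / 2" using reals_Archimedean[of "e / 2"] e by auto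
    define d where "d = inverse (real (Suc l)) / 2"
    have d: "d > 0" by (simp add: d_def)
    have "uniformly_continuous_map m euclidean_metric f"
      using f comp by (intro continuous_imp_uniformly_continuous_map) (simp add: continuous_functions_def)
    then obtain \<delta> where \<delta>: "\<delta> > 0"
      "\<And>s t. s \<in> mspace m \<Longrightarrow> t \<in> mspace m \<Longrightarrow> mdist m s t < \<delta> \<Longrightarrow> dist (f s) (f t) < d"
      unfolding uniformly_continuous_map_def using d by (auto; metis)
    obtain k where k: "inverse (real (Suc k)) < \<delta>" using reals_Archimedean[OF \<delta>(1)] by auto
    have "\<forall>c. \<exists>v\<in>D. dist v (f c) < d" using D(2)[OF d] by blast
    then obtain h0 where h0: "\<And>c. h0 c \<in> D" "\<And>c. dist (h0 c) (f c) < d" by metis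
    define h where "h = restrict h0 (K k)"
    have "h \<in> PiE (K k) (\<lambda>_. D)" using h0 by (auto simp: h_def)
    then have U: "V k l h \<in> \<U>" by (auto simp: \<U>_def)
    have "f \<in> V k l h"
      unfolding V_def
    proof (intro CollectI ballI impI)
      fix c t assume c: "c \<in> K k" and t: "t \<in> mspace m" and ct: "mdist m c t < inverse (real (Suc k))"
      have "dist (f c) (f t) < d" using c t ct k K(2) by (intro \<delta>(2)) auto
      moreover have "dist (h c) (f c) < d" using h0 c by (simp add: h_def)
      moreover have "dist (f t) (h c) \<le> dist (f c) (f t) + dist (h c) (f c)"
        by (metis add.commute dist_commute dist_triangle)
      moreover have "d + d = inverse (real (Suc l))" by (simp add: d_def)
      ultimately show "norm (f t - h c) < inverse (real (Suc l))" unfolding dist_norm by linarith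
    qed
    moreover have "norm (f t - g t) < e" if g: "g \<in> V k l h" and fV: "f \<in> V k l h" and t: "t \<in> mspace m" for g t
    proof -
      obtain c where c: "c \<in> K k" "mdist m c t < inverse (Suc k)" using K(3)[OF t] by blast
      have "norm (g t - h c) < inverse (Suc l)" "norm (f t - h c) < inverse (Suc l)"
        using g fV c t unfolding V_def by blast+
      moreover have "norm (f t - g t) \<le> norm (f t - h c) + norm (g t - h c)"
        using norm_triangle_ineq4[of "f t - h c" "g t - h c"] by simp
      ultimately show ?thesis using l by linarith
    qed
    ultimately show ?thesis using U by blast
  qed
  ultimately show ?thesis using that by blast
qed

lemma continuous_functions_bounded:
  fixes f :: "'t \<Rightarrow> real ^ 'd"
  assumes "compact_space (mtopology_of m)" and "f \<in> continuous_functions m"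
  obtains B where "\<And>t. t \<in> mspace m \<Longrightarrow> norm (f t) \<le> B"
proof -
  have "compactin euclidean (f ` mspace m)"
    using assms image_compactin[of "mtopology_of m" "mspace m" euclidean f]
    by (simp add: compact_space_def continuous_functions_def)
  then have "bounded (f ` mspace m)" by (simp add: compact_imp_bounded)
  then show ?thesis using that by (auto simp: bounded_iff)
qed

lemma continuous_functions_diff:
  "f \<in> continuous_functions m \<Longrightarrow> g \<in> continuous_functions m \<Longrightarrow> (\<lambda>t. f t - g t) \<in> continuous_functions m"
  by (rule continuous_functionsI_sequentially, rule tendsto_diff)
     (erule (1) continuous_functions_sequentially)+

lemma infnorm_le_sup_norm:
  fixes f :: "'t \<Rightarrow> real ^ 'd"
  assumes comp: "compact_space (mtopology_of m)" and f: "f \<in> continuous_functions m" and t: "t \<in> mspace m"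
  shows "infnorm (f t) \<le> sup_norm m f"
proof -
  obtain B where B: "\<And>t. t \<in> mspace m \<Longrightarrow> norm (f t) \<le> B"
    using continuous_functions_bounded[OF comp f] by blast
  have "bdd_above ((\<lambda>t. infnorm (f t)) ` mspace m)"
    by (rule bdd_aboveI[of _ B]) (use B infnorm_le_norm order_trans in fastforce)
  then show ?thesis unfolding sup_norm_def by (rule cSUP_upper[OF t])
qed

lemma sup_norm_le:
  assumes "mspace m \<noteq> {}" and "\<And>t. t \<in> mspace m \<Longrightarrow> infnorm (f t) \<le> c"
  shows "sup_norm m f \<le> c"
  unfolding sup_norm_def using assms by (rule cSUP_least)

section \<open>Continuous processes and the sum norm\<close>

locale continuous_process = stationary_process P M X a n p r
  for P :: "'w measure" and M :: "'t measure" and X :: "'t \<Rightarrow> 'w \<Rightarrow> real ^ 'd"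
    and a :: "nat \<Rightarrow> 't \<Rightarrow> real ^ 'd" and n :: nat and p r :: real +
  fixes m :: "'t metric" and x :: "real ^ 'd" and T0 :: "'t set"
  assumes p_eq_1: "p = 1"
    and borel: "compact_metric_borel m M" and atomless: "continuous_measure M"
    and paths: "\<And>\<omega>. \<omega> \<in> space P \<Longrightarrow> (\<lambda>t. X t \<omega>) \<in> continuous_functions m"
    and T0_closed: "closedin (mtopology_of m) T0" and T0_null: "emeasure M T0 = 0"
    and support: "path_support P m X = {f \<in> continuous_functions m. \<forall>t\<in>T0. f t = x}"
    and marginal: "\<And>t j. t \<in> space M - T0 \<Longrightarrow> continuous_measure (distr P borel (\<lambda>\<omega>. X t \<omega> $ j))"
    and nontrivial: "emeasure M (space M) \<noteq> 0"
begin

lemma mspace_eq: "mspace m = space M" and compact: "compact_space (mtopology_of m)"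
  using borel by (auto simp: compact_metric_borel_def)

lemma open_in_sets: "openin (mtopology_of m) U \<Longrightarrow> U \<in> sets M"
  using borel unfolding compact_metric_borel_def by (auto intro: sigma_sets.Basic)

lemma closed_in_sets: "closedin (mtopology_of m) S \<Longrightarrow> S \<in> sets M"
proof -
  assume S: "closedin (mtopology_of m) S"
  then have "space M - (space M - S) \<in> sets M"
    using open_in_sets[of "space M - S"] by (auto simp: closedin_def mspace_eq)
  moreover have "space M - (space M - S) = S" using closedin_subset[OF S] by (auto simp: mspace_eq)
  ultimately show ?thesis by simp
qed

lemma continuous_real_measurable:
  fixes g :: "'t \<Rightarrow> 'b::topological_space"
  assumes "continuous_map (mtopology_of m) euclidean g"
  shows "g \<in> borel_measurable M"
proof (rule borel_measurableI)
  fix S :: "'b set" assume "open S"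
  then have "openin (mtopology_of m) {t \<in> mspace m. g t \<in> S}"
    using openin_continuous_map_preimage[OF assms, of S] by simp
  then have "{t \<in> mspace m. g t \<in> S} \<in> sets M" by (rule open_in_sets)
  moreover have "{t \<in> mspace m. g t \<in> S} = g -` S \<inter> space M" by (auto simp: mspace_eq)
  ultimately show "g -` S \<inter> space M \<in> sets M" by simp
qed

lemma continuous_measurable: "f \<in> continuous_functions m \<Longrightarrow> f \<in> borel_measurable M"
  by (simp add: continuous_functions_def continuous_real_measurable)

lemma T0_in_sets: "T0 \<in> sets M" and T0_sub: "T0 \<subseteq> space M"
  using closed_in_sets[OF T0_closed] closedin_subset[OF T0_closed] by (auto simp: mspace_eq)

lemma AE_not_T0: "AE t in M. t \<notin> T0"
  using T0_in_sets T0_null by (intro AE_not_in) (simp add: null_sets_def)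

lemma bounded_l1_integrable:
  fixes f :: "'t \<Rightarrow> real ^ 'd"
  assumes f: "f \<in> continuous_functions m"
  shows "integrable M (\<lambda>t. \<Sum>j\<in>UNIV. \<bar>f t $ j\<bar>)"
proof -
  obtain B where B: "\<And>t. t \<in> mspace m \<Longrightarrow> norm (f t) \<le> B"
    by (rule continuous_functions_bounded[OF compact f]) blast
  note [measurable] = continuous_measurable[OF f]
  have "(\<Sum>j\<in>UNIV. \<bar>f t $ j\<bar>) \<le> (\<Sum>j\<in>(UNIV :: 'd set). B)" if "t \<in> space M" for t
    using B[of t] that component_le_norm_cart[of "f t"] by (intro sum_mono) (auto simp: mspace_eq intro: order_trans)
  then have "AE t in M. norm (\<Sum>j\<in>UNIV. \<bar>f t $ j\<bar>) \<le> real CARD('d) * B"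
    by (intro AE_I2) (simp add: abs_of_nonneg sum_nonneg)
  then show ?thesis by (rule M.integrable_const_bound) measurable
qed

lemma continuous_in_Lp:
  fixes f :: "'t \<Rightarrow> real ^ 'd"
  shows "f \<in> continuous_functions m \<Longrightarrow> f \<in> Lp_space M p"
  using bounded_l1_integrable[of f] continuous_measurable[of f] p_eq_1 by (simp add: Lp_space_iff)

lemma Lp_norm_l1: "Lp_norm M p f = (LINT t|M. (\<Sum>j\<in>UNIV. \<bar>f t $ j\<bar>))"
proof -
  have "Lp_energy M p f = (LINT t|M. (\<Sum>j\<in>UNIV. \<bar>f t $ j\<bar>))"
    by (simp add: Lp_energy_def p_eq_1)
  moreover have "Lp_norm M p f = Lp_energy M p f"
    using Lp_norm_eq_energy[OF p_pos, of M f] Lp_energy_nonneg[of M p f] p_eq_1 by simp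
  ultimately show ?thesis by simp
qed

lemma Lp_norm_le_sup_norm:
  fixes f :: "'t \<Rightarrow> real ^ 'd"
  assumes f: "f \<in> continuous_functions m"
  shows "Lp_norm M p f \<le> real CARD('d) * measure M (space M) * sup_norm m f"
proof -
  have "(\<Sum>j\<in>UNIV. \<bar>f t $ j\<bar>) \<le> (\<Sum>j\<in>(UNIV :: 'd set). sup_norm m f)" if "t \<in> space M" for t
    using infnorm_le_sup_norm[OF compact f, of t] that component_le_infnorm_cart[of "f t"]
    by (intro sum_mono) (auto simp: mspace_eq intro: order_trans)
  then have "(LINT t|M. (\<Sum>j\<in>UNIV. \<bar>f t $ j\<bar>)) \<le> (LINT t|M. real CARD('d) * sup_norm m f)"
    using bounded_l1_integrable[OF f] by (intro integral_mono) auto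
  then show ?thesis by (simp add: Lp_norm_l1 mult_ac)
qed

text \<open>By continuity the supremum may be taken over a countable dense set.\<close>

lemma sup_norm_event:
  assumes f: "f \<in> continuous_functions m"
  shows "{\<omega> \<in> space P. sup_norm m (\<lambda>t. X t \<omega> - f t) < e} \<in> sets P"
proof -
  obtain K where K: "\<And>k. finite (K k)" "\<And>k. K k \<subseteq> mspace m"
    "\<And>k t. t \<in> mspace m \<Longrightarrow> \<exists>c\<in>K k. mdist m c t < inverse (Suc k)"
    by (rule finite_nets[OF compact]) blast
  define D where "D = (\<Union>k. K k)"
  have D: "countable D" "D \<subseteq> space M"
    unfolding D_def using K(2) by (auto simp: mspace_eq intro: countable_UN countable_finite[OF K(1)])
  have ne: "mspace m \<noteq> {}" using nontrivial by (auto simp: mspace_eq)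
  have "{\<omega> \<in> space P. sup_norm m (\<lambda>t. X t \<omega> - f t) < e} =
    (\<Union>q\<in>{q \<in> \<rat>. q < e}. {\<omega> \<in> space P. \<forall>t\<in>D. infnorm (X t \<omega> - f t) \<le> q})"
  proof (intro set_eqI iffI)
    fix \<omega> assume w: "\<omega> \<in> {\<omega> \<in> space P. sup_norm m (\<lambda>t. X t \<omega> - f t) < e}"
    then obtain q where q: "q \<in> \<rat>" "sup_norm m (\<lambda>t. X t \<omega> - f t) < q" "q < e"
      using Rats_dense_in_real by blast
    have "infnorm (X t \<omega> - f t) \<le> q" if "t \<in> D" for t
      using infnorm_le_sup_norm[OF compact continuous_functions_diff[OF paths f], of \<omega> t] w q D that
      by (auto simp: mspace_eq)
    then show "\<omega> \<in> (\<Union>q\<in>{q \<in> \<rat>. q < e}. {\<omega> \<in> space P. \<forall>t\<in>D. infnorm (X t \<omega> - f t) \<le> q})"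
      using q w by auto
  next
    fix \<omega> assume "\<omega> \<in> (\<Union>q\<in>{q \<in> \<rat>. q < e}. {\<omega> \<in> space P. \<forall>t\<in>D. infnorm (X t \<omega> - f t) \<le> q})"
    then obtain q where q: "q < e" "\<omega> \<in> space P" "\<And>t. t \<in> D \<Longrightarrow> infnorm (X t \<omega> - f t) \<le> q" by blast
    have cont: "continuous_map (mtopology_of m) euclidean (\<lambda>t. infnorm (X t \<omega> - f t))"
      by (rule continuous_map_sequentiallyI)
         (intro tendsto_infnorm tendsto_diff continuous_functions_sequentially[OF paths[OF q(2)]]
           continuous_functions_sequentially[OF f])
    have "infnorm (X t \<omega> - f t) \<le> q" if "t \<in> mspace m" for t
      by (rule continuous_le_dense[OF K(3) K(2) cont _ that]) (use q(3) in \<open>auto simp: D_def\<close>)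
    then have "sup_norm m (\<lambda>t. X t \<omega> - f t) \<le> q" by (rule sup_norm_le[OF ne])
    then show "\<omega> \<in> {\<omega> \<in> space P. sup_norm m (\<lambda>t. X t \<omega> - f t) < e}" using q by simp
  qed
  also have "\<dots> \<in> sets P"
  proof (rule sets.countable_UN'')
    show "countable {q \<in> \<rat>. q < e}" by (auto intro: countable_subset[OF _ countable_rat])
    have meas: "(\<lambda>\<omega>. infnorm (X t \<omega> - f t)) \<in> borel_measurable P" if "t \<in> D" for t
    proof -
      have [measurable]: "X t \<in> borel_measurable P" using that D by (intro X_section) auto
      show ?thesis
        by (rule measurable_compose[of "\<lambda>\<omega>. X t \<omega> - f t" P borel infnorm borel])
           (auto intro!: borel_measurable_continuous_onI continuous_intros)
    qed
    show "{\<omega> \<in> space P. \<forall>t\<in>D. infnorm (X t \<omega> - f t) \<le> q} \<in> sets P" for q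
      by (rule sets.sets_Collect_countable_All'[OF borel_measurable_le[OF meas borel_measurable_const] D(1)])
  qed
  finally show ?thesis .
qed

text \<open>A path outside of the support is the centre of a ball of probability \<open>0\<close>. By separability countably
  many such balls contain all these paths, so that almost every path lies in the support.\<close>

lemma path_on_T0:
  assumes s: "s \<in> T0"
  shows "AE \<omega> in P. X s \<omega> = x"
proof -
  obtain \<U> :: "('t \<Rightarrow> real ^ 'd) set set" where U: "countable \<U>"
    "\<And>f e. f \<in> continuous_functions m \<Longrightarrow> e > 0 \<Longrightarrow>
      \<exists>U\<in>\<U>. f \<in> U \<and> (\<forall>g\<in>U. \<forall>t\<in>mspace m. norm (f t - g t) < e)"
    by (rule continuous_functions_countable_cover[OF compact]) blast
  \<comment> \<open>The continuous functions in \<open>U\<close> lie in a ball of probability \<open>0\<close>; the members \<open>U\<close> of the countable family with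
    this property are collected in \<open>\<V>\<close>.\<close>
  define null_ball where "null_ball f e U \<longleftrightarrow> f \<in> continuous_functions m \<and>
    \<P>(\<omega> in P. sup_norm m (\<lambda>t. X t \<omega> - f t) < e) = 0 \<and>
    (\<forall>g\<in>U \<inter> continuous_functions m. sup_norm m (\<lambda>t. g t - f t) < e)" for f e U
  define \<V> where "\<V> = {U \<in> \<U>. \<exists>f e. null_ball f e U}"
  have "\<forall>U\<in>\<V>. \<exists>f e. null_ball f e U" by (simp add: \<V>_def)
  then obtain F E where FE: "\<And>U. U \<in> \<V> \<Longrightarrow> null_ball (F U) (E U) U" by metis
  have ne: "mspace m \<noteq> {}" using nontrivial by (auto simp: mspace_eq)
  have "AE \<omega> in P. \<forall>U\<in>\<V>. \<not> sup_norm m (\<lambda>t. X t \<omega> - F U t) < E U"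
  proof (rule AE_ball_countable[THEN iffD2])
    show "countable \<V>" using U(1) by (auto simp: \<V>_def intro: countable_subset)
    show "\<forall>U\<in>\<V>. AE \<omega> in P. \<not> sup_norm m (\<lambda>t. X t \<omega> - F U t) < E U"
    proof
      fix U assume "U \<in> \<V>"
      then have "F U \<in> continuous_functions m" "\<P>(\<omega> in P. sup_norm m (\<lambda>t. X t \<omega> - F U t) < E U) = 0"
        using FE by (auto simp: null_ball_def)
      then show "AE \<omega> in P. \<not> sup_norm m (\<lambda>t. X t \<omega> - F U t) < E U"
        using sup_norm_event by (subst (asm) prob_eq_0) auto
    qed
  qed
  then show ?thesis using AE_space
  proof eventually_elim
    case (elim \<omega>)
    define f where "f t = X t \<omega>" for t
    have f: "f \<in> continuous_functions m" using paths[OF elim(2)] by (simp add: f_def[abs_def])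
    show "X s \<omega> = x"
    proof (rule ccontr)
      assume "X s \<omega> \<noteq> x"
      then have "f \<notin> path_support P m X" using s support by (auto simp: f_def)
      then obtain e where e: "e > 0" "\<not> \<P>(\<omega> in P. sup_norm m (\<lambda>t. X t \<omega> - f t) < e) > 0"
        using f unfolding path_support_def by blast
      then have null: "\<P>(\<omega> in P. sup_norm m (\<lambda>t. X t \<omega> - f t) < e) = 0"
        using measure_nonneg[of P] by (simp add: not_less antisym)
      obtain V where V: "V \<in> \<U>" "f \<in> V" "\<forall>g\<in>V. \<forall>t\<in>mspace m. norm (f t - g t) < e / 2"
        using U(2)[OF f, of "e / 2"] e(1) by auto
      have "sup_norm m (\<lambda>t. g t - f t) < e" if "g \<in> V" for g
      proof -
        have "infnorm (g t - f t) \<le> e / 2" if "t \<in> mspace m" for t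
          using V(3) \<open>g \<in> V\<close> that infnorm_le_norm[of "g t - f t"]
          by (metis less_imp_le norm_minus_commute order_trans)
        then have "sup_norm m (\<lambda>t. g t - f t) \<le> e / 2" by (rule sup_norm_le[OF ne])
        then show ?thesis using e(1) by simp
      qed
      then have "null_ball f e V" using f null by (simp add: null_ball_def)
      then have VV: "V \<in> \<V>" using V(1) by (auto simp: \<V>_def)
      then have "sup_norm m (\<lambda>t. f t - F V t) < E V"
        using FE[OF VV] V(2) f by (auto simp: null_ball_def)
      then show False using elim(1) VV by (auto simp: f_def)
    qed
  qed
qed

lemma marginal_atomless:
  assumes t: "t \<in> space M - T0"
  shows "AE \<omega> in P. X t \<omega> $ j \<noteq> y"
proof -
  have [measurable]: "X t \<in> borel_measurable P" using t by (intro X_section) auto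
  have "emeasure (distr P borel (\<lambda>\<omega>. X t \<omega> $ j)) {y} = 0"
    using marginal[OF t, of j] by (simp add: continuous_measure_def)
  then have "emeasure P {\<omega> \<in> space P. X t \<omega> $ j = y} = 0"
    by (subst (asm) emeasure_distr) (auto simp: vimage_def Int_def conj_commute)
  then show ?thesis by (intro AE_I[where N = "{\<omega> \<in> space P. X t \<omega> $ j = y}"]) auto
qed

text \<open>For almost every \<open>t\<close> the law of \<open>X t\<close> has no atom at \<open>a i t\<close>. By Fubini almost every path then
  differs from \<open>a i\<close> at almost every \<open>t\<close>, so it does not coincide with \<open>a i\<close>.\<close>

lemma all_indices:
  assumes i: "i \<in> {1..n}"
  shows "i \<in> index_set P M p r X n a"
proof -
  interpret pair_sigma_finite P M by unfold_locales
  note [measurable] = Lp_measurable[OF a_Lp[OF i]]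
  have "AE t in M. AE \<omega> in P. X t \<omega> \<noteq> a i t"
    using AE_not_T0 AE_space
  proof eventually_elim
    case (elim t)
    fix j
    have "AE \<omega> in P. X t \<omega> $ j \<noteq> a i t $ j" using elim by (intro marginal_atomless) auto
    then show ?case by eventually_elim auto
  qed
  moreover have "{z \<in> space (P \<Otimes>\<^sub>M M). X (snd z) (fst z) \<noteq> a i (snd z)} \<in> sets (P \<Otimes>\<^sub>M M)"
    by measurable
  ultimately have "AE \<omega> in P. AE t in M. X t \<omega> \<noteq> a i t"
    using AE_commute[of "\<lambda>\<omega> t. X t \<omega> \<noteq> a i t"] by simp
  then have "AE \<omega> in P. \<not> (AE t in M. X t \<omega> = a i t)"
  proof eventually_elim
    case (elim \<omega>)
    show ?case
    proof
      assume "AE t in M. X t \<omega> = a i t"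
      with elim have "AE t in M. False" by eventually_elim simp
      then show False using nontrivial by (simp add: AE_iff_null null_sets_def)
    qed
  qed
  then have "\<P>(\<omega> in P. AE t in M. X t \<omega> = a i t) = 0"
    using path_eq_event[OF Lp_measurable[OF a_Lp[OF i]]] by (subst prob_eq_0) auto
  then show ?thesis using i by (simp add: index_set_def)
qed

lemma singleton_null:
  assumes "t \<in> space M"
  shows "closedin (mtopology_of m) {t}" and "AE s in M. s \<noteq> t"
proof -
  interpret Metric_space "mspace m" "mdist m" by (rule Metric_space_mspace_mdist)
  show cl: "closedin (mtopology_of m) {t}"
  proof (rule closedin_Hausdorff_singleton)
    show "Hausdorff_space (mtopology_of m)"
      using Hausdorff_space_mtopology by (simp add: mtopology_of_def)
  qed (simp add: mspace_eq assms)
  have "{t} \<in> null_sets M"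
    using atomless assms closed_in_sets[OF cl] by (auto simp: null_sets_def continuous_measure_def)
  then show "AE s in M. s \<noteq> t" using AE_not_in by force
qed

text \<open>The strict cell is open for the integral norm and contains a continuous path \<open>f\<close>. Changing \<open>f\<close> on a
  small neighbourhood of the null set \<open>insert t T0\<close> is invisible to that norm, but prescribes the
  values on \<open>T0\<close>, which puts the function into the support, and any value \<open>v\<close> at \<open>t\<close>.\<close>

lemma cell_path_through:
  assumes i: "i \<in> {1..n}" and t: "t \<in> space M - T0"
  obtains h where "h \<in> path_support P m X" and "h \<in> strict_cell M p n a i" and "h t = v"
proof -
  obtain \<omega> where w: "\<omega> \<in> space P" "(\<lambda>t. X t \<omega>) \<in> strict_cell M p n a i"
  proof -
    have "{\<omega> \<in> space P. (\<lambda>t. X t \<omega>) \<in> strict_cell M p n a i} \<noteq> {}"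
      using cell_event(1)[OF i] by (metis (no_types, lifting) less_irrefl measure_empty)
    then show ?thesis using that by blast
  qed
  define f where "f t = X t \<omega>" for t
  have f: "f \<in> continuous_functions m" "f \<in> strict_cell M p n a i"
    using w paths[OF w(1)] by (simp_all add: f_def[abs_def])
  obtain \<delta> where \<delta>: "\<delta> > 0" "\<And>g. g \<in> Lp_space M p \<Longrightarrow> Lp_norm M p (\<lambda>t. g t - f t) < \<delta> \<Longrightarrow> g \<in> strict_cell M p n a i"
    by (rule strict_cell_open[where M = M and p = p and n = n and a = a and i = i and f = f])
       (use p_ge_1 a_Lp i f in auto)
  obtain g0 :: "'t \<Rightarrow> real" where g0: "continuous_map (mtopology_of m) euclidean g0"
    "\<And>s. s \<in> mspace m \<Longrightarrow> g0 s \<ge> 0" "\<And>s. s \<in> mspace m \<Longrightarrow> g0 s = 0 \<longleftrightarrow> s \<in> T0"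
    by (rule closed_zero_set[OF T0_closed]) blast
  have tm: "t \<in> mspace m" "t \<in> space M" using t by (auto simp: mspace_eq)
  obtain g1 :: "'t \<Rightarrow> real" where g1: "continuous_map (mtopology_of m) euclidean g1"
    "\<And>s. s \<in> mspace m \<Longrightarrow> g1 s \<ge> 0" "\<And>s. s \<in> mspace m \<Longrightarrow> g1 s = 0 \<longleftrightarrow> s \<in> {t}"
    by (rule closed_zero_set[OF singleton_null(1)[OF tm(2)]]) blast
  have g0t: "g0 t > 0" using g0(2,3)[OF tm(1)] t by (simp add: less_le)
  \<comment> \<open>The target \<open>G\<close> has the prescribed values on the null set \<open>insert t T0\<close>; \<open>h k\<close> leaves it
    for \<open>f\<close> at a rate that grows with \<open>k\<close>.\<close>
  define G where "G s = x + (g0 s / g0 t) *\<^sub>R (v - x)" for s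
  define c where "c k s = min 1 (real k * (g0 s * g1 s))" for k s
  define h where "h k s = G s + c k s *\<^sub>R (f s - G s)" for k s
  have seq: "(\<lambda>k. g0 (\<sigma> k)) \<longlonglongrightarrow> g0 s" "(\<lambda>k. g1 (\<sigma> k)) \<longlonglongrightarrow> g1 s"
    if "limitin (mtopology_of m) \<sigma> s sequentially" for \<sigma> s
    using continuous_map_limit[OF g0(1) that] continuous_map_limit[OF g1(1) that] by (simp_all add: o_def)
  have G: "G \<in> continuous_functions m"
    unfolding G_def[abs_def] using g0t
    by (intro continuous_functionsI_sequentially tendsto_intros seq) auto
  have hc: "h k \<in> continuous_functions m" for k
    unfolding h_def[abs_def] c_def
    by (intro continuous_functionsI_sequentially tendsto_intros seq
        continuous_functions_sequentially[OF f(1)] continuous_functions_sequentially[OF G])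
  have hT0: "h k s = x" if "s \<in> T0" for k s
    using g0(3)[of s] that T0_sub by (auto simp: h_def c_def G_def mspace_eq)
  have ht: "h k t = v" for k
    using g1(3)[OF tm(1)] g0t by (simp add: h_def c_def G_def)
  have c01: "0 \<le> c k s" "c k s \<le> 1" if "s \<in> space M" for k s
    using g0(2)[of s] g1(2)[of s] that by (auto simp: c_def mspace_eq)
  have lim: "(\<lambda>k. Lp_norm M p (\<lambda>s. h k s - f s)) \<longlonglongrightarrow> (LINT s|M. 0)"
    unfolding Lp_norm_l1
  proof (rule integral_dominated_convergence)
    show "integrable M (\<lambda>s. \<Sum>j\<in>UNIV. \<bar>(f s - G s) $ j\<bar>)"
      using bounded_l1_integrable[OF continuous_functions_diff[OF f(1) G]] by simp
    show "(\<lambda>s. \<Sum>j\<in>UNIV. \<bar>(h k s - f s) $ j\<bar>) \<in> borel_measurable M" for k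
      using bounded_l1_integrable[OF continuous_functions_diff[OF hc f(1)]] by (rule borel_measurable_integrable)
    have diff: "\<bar>(h k s - f s) $ j\<bar> = \<bar>1 - c k s\<bar> * \<bar>(f s - G s) $ j\<bar>" for k s j
    proof -
      have "(h k s - f s) $ j = - ((1 - c k s) * (f s - G s) $ j)"
        by (simp add: h_def algebra_simps)
      then show ?thesis by (simp only: abs_minus_cancel abs_mult)
    qed
    show "AE s in M. norm (\<Sum>j\<in>UNIV. \<bar>(h k s - f s) $ j\<bar>) \<le> (\<Sum>j\<in>UNIV. \<bar>(f s - G s) $ j\<bar>)" for k
    proof (rule AE_I2)
      fix s assume s: "s \<in> space M"
      have "\<bar>1 - c k s\<bar> * \<bar>(f s - G s) $ j\<bar> \<le> 1 * \<bar>(f s - G s) $ j\<bar>" for j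
        using c01[OF s, of k] by (intro mult_right_mono) auto
      then show "norm (\<Sum>j\<in>UNIV. \<bar>(h k s - f s) $ j\<bar>) \<le> (\<Sum>j\<in>UNIV. \<bar>(f s - G s) $ j\<bar>)"
        unfolding diff by (simp add: abs_of_nonneg sum_nonneg sum_mono)
    qed
    show "AE s in M. (\<lambda>k. \<Sum>j\<in>UNIV. \<bar>(h k s - f s) $ j\<bar>) \<longlonglongrightarrow> 0"
      using AE_not_T0 singleton_null(2)[OF tm(2)] AE_space
    proof eventually_elim
      case (elim s)
      then have pos: "g0 s * g1 s > 0" using g0(2,3)[of s] g1(2,3)[of s] by (simp add: mspace_eq less_le)
      obtain k0 :: nat where k0: "inverse (g0 s * g1 s) \<le> real k0" using real_arch_simple by blast
      have "c k s = 1" if "k \<ge> k0" for k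
      proof -
        have "1 = inverse (g0 s * g1 s) * (g0 s * g1 s)"
          by (rule left_inverse[symmetric]) (use pos in auto)
        also have "\<dots> \<le> real k * (g0 s * g1 s)" using k0 that pos by (intro mult_right_mono) auto
        finally show ?thesis by (simp add: c_def)
      qed
      then have "\<forall>\<^sub>F k in sequentially. (\<Sum>j\<in>UNIV. \<bar>(h k s - f s) $ j\<bar>) = 0"
        unfolding diff by (intro eventually_mono[OF eventually_ge_at_top[of k0]]) simp
      then show ?case by (rule tendsto_eventually)
    qed
  qed simp
  then have "\<forall>\<^sub>F k in sequentially. Lp_norm M p (\<lambda>s. h k s - f s) < \<delta>"
    using \<delta>(1) by (auto dest: order_tendstoD(2))
  then obtain k where k: "Lp_norm M p (\<lambda>s. h k s - f s) < \<delta>" by (auto simp: eventually_sequentially)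
  show ?thesis
  proof (rule that[of "h k"])
    show "h k \<in> path_support P m X" unfolding support using hc hT0 by blast
    show "h k \<in> strict_cell M p n a i" by (rule \<delta>(2)[OF continuous_in_Lp[OF hc] k])
  qed (rule ht)
qed

text \<open>Paths uniformly close to a function of the support occur with positive probability, and they stay
  in the open cell and in the open interval.\<close>

lemma cell_charges_intervals:
  assumes i: "i \<in> {1..n}" and t: "t \<in> space M - T0" and uv: "u < v"
  shows "\<not> (AE \<omega> in P. (\<lambda>t. X t \<omega>) \<in> strict_cell M p n a i \<longrightarrow> \<not> (u < X t \<omega> $ j \<and> X t \<omega> $ j < v))"
proof
  assume ae: "AE \<omega> in P. (\<lambda>t. X t \<omega>) \<in> strict_cell M p n a i \<longrightarrow> \<not> (u < X t \<omega> $ j \<and> X t \<omega> $ j < v)"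
  obtain h where h: "h \<in> path_support P m X" "h \<in> strict_cell M p n a i" "h t = vec ((u + v) / 2)"
    by (rule cell_path_through[OF i t])
  have hc: "h \<in> continuous_functions m" using h(1) by (simp add: path_support_def)
  obtain \<delta> where \<delta>: "\<delta> > 0" "\<And>g. g \<in> Lp_space M p \<Longrightarrow> Lp_norm M p (\<lambda>t. g t - h t) < \<delta> \<Longrightarrow> g \<in> strict_cell M p n a i"
    by (rule strict_cell_open[where M = M and p = p and n = n and a = a and i = i and f = h])
       (use p_ge_1 a_Lp i h in auto)
  define c where "c = real CARD('d) * measure M (space M)"
  have c: "c \<ge> 0" by (simp add: c_def)
  \<comment> \<open>A sup norm below \<open>e\<close> keeps \<open>X t \<omega> $ j\<close> between \<open>u\<close> and \<open>v\<close> and the integral norm below \<open>\<delta>\<close>.\<close>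
  define e where "e = min ((v - u) / 2) (\<delta> / (c + 1))"
  have e: "e > 0" using uv \<delta>(1) c by (simp add: e_def)
  have "AE \<omega> in P. \<not> sup_norm m (\<lambda>t. X t \<omega> - h t) < e"
    using ae AE_space
  proof eventually_elim
    case (elim \<omega>)
    show ?case
    proof
      assume near: "sup_norm m (\<lambda>t. X t \<omega> - h t) < e"
      note dc = continuous_functions_diff[OF paths[OF elim(2)] hc]
      have "Lp_norm M p (\<lambda>t. X t \<omega> - h t) \<le> c * sup_norm m (\<lambda>t. X t \<omega> - h t)"
        using Lp_norm_le_sup_norm[OF dc] by (simp add: c_def)
      also have "\<dots> \<le> c * (\<delta> / (c + 1))"
        using near c by (intro mult_left_mono) (auto simp: e_def)
      also have "\<dots> < \<delta>" using c \<delta>(1) by (simp add: field_simps)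
      finally have "(\<lambda>t. X t \<omega>) \<in> strict_cell M p n a i"
        by (intro \<delta>(2) continuous_in_Lp paths elim)
      moreover have "\<bar>X t \<omega> $ j - (u + v) / 2\<bar> < (v - u) / 2"
      proof -
        have "\<bar>(X t \<omega> - h t) $ j\<bar> \<le> infnorm (X t \<omega> - h t)" by (rule component_le_infnorm_cart)
        also have "\<dots> \<le> sup_norm m (\<lambda>t. X t \<omega> - h t)"
          using infnorm_le_sup_norm[OF compact dc, of t] t by (simp add: mspace_eq)
        also have "\<dots> < (v - u) / 2" using near by (simp add: e_def)
        finally show ?thesis by (simp add: h(3))
      qed
      then have "u < X t \<omega> $ j" "X t \<omega> $ j < v" unfolding abs_less_iff by (simp_all add: field_simps)
      ultimately show False using elim(1) by blast
    qed
  qed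
  then have "\<P>(\<omega> in P. sup_norm m (\<lambda>t. X t \<omega> - h t) < e) = 0"
    using sup_norm_event[OF hc] by (subst prob_eq_0) auto
  moreover have "\<P>(\<omega> in P. sup_norm m (\<lambda>t. X t \<omega> - h t) < e) > 0"
    using h(1) e by (simp add: path_support_def)
  ultimately show False by simp
qed

text \<open>For \<open>p = 1\<close> the signed power is the sign, whose increment from \<open>u - X t\<close> to \<open>v - X t\<close> is positive only
  if \<open>X t\<close> lies between \<open>u\<close> and \<open>v\<close>. The balance increases strictly because the cell charges every
  interval.\<close>

lemma continuous_sign_change:
  assumes i: "i \<in> {1..n}" and t: "t \<in> space M"
  shows "\<exists>c. changes_sign_at (cell_balance i j t) c"
proof (cases "t \<in> T0")
  case True
  have "AE \<omega> in P. X t \<omega> $ j = x $ j" using path_on_T0[OF True] by eventually_elim simp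
  then show ?thesis
    using weighted_process.balance_changes_sign_const[OF cell_process[OF all_indices[OF i]] t] by blast
next
  case False
  note wp = cell_process[OF all_indices[OF i], of j]
  have "strict_mono (cell_balance i j t)"
  proof (rule strict_monoI)
    fix u v :: real assume uv: "u < v"
    show "cell_balance i j t u < cell_balance i j t v"
    proof (rule weighted_process.balance_strict[OF wp t less_imp_le[OF uv]], rule notI)
      assume ae: "AE \<omega> in P. cell_weight i \<omega> = 0 \<or>
        signed_powr (p - 1) (v - X t \<omega> $ j) = signed_powr (p - 1) (u - X t \<omega> $ j)"
      have "AE \<omega> in P. (\<lambda>t. X t \<omega>) \<in> strict_cell M p n a i \<longrightarrow> \<not> (u < X t \<omega> $ j \<and> X t \<omega> $ j < v)"
        using ae cell_weight_pos[OF all_indices[OF i]]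
        by eventually_elim (auto simp: p_eq_1 signed_powr_zero_exponent)
      then show False using cell_charges_intervals[OF i _ uv, of t j] t False by blast
    qed
  qed
  then show ?thesis by (rule weighted_process.balance_changes_sign[OF wp t])
qed

text \<open>Along a sequence tending to \<open>s\<close> the paths converge. The signs converge where \<open>X s\<close> differs from \<open>y\<close>,
  that is, almost surely: off \<open>T0\<close> the law has no atoms, and on \<open>T0\<close> its only atom is the sign change.\<close>

lemma sign_change_continuous_function:
  assumes i: "i \<in> {1..n}" and b: "\<And>t j. t \<in> space M \<Longrightarrow> changes_sign_at (cell_balance i j t) (b t $ j)"
  shows "b \<in> continuous_functions m"
proof (rule continuous_functionsI_sequentially)
  fix s \<sigma> assume s: "s \<in> mspace m" and \<sigma>: "range \<sigma> \<subseteq> mspace m"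
    and lim: "limitin (mtopology_of m) \<sigma> s sequentially"
  have sM: "s \<in> space M" and \<sigma>M: "\<And>k. \<sigma> k \<in> space M" using s \<sigma> by (auto simp: mspace_eq)
  have "(\<lambda>k. b (\<sigma> k) $ j) \<longlonglongrightarrow> b s $ j" for j
  proof (rule sign_change_tendsto[where f = "\<lambda>k. cell_balance i j (\<sigma> k)"])
    note wp = cell_process[OF all_indices[OF i], of j]
    fix y assume y: "y \<noteq> b s $ j"
    have ne: "AE \<omega> in P. X s \<omega> $ j \<noteq> y"
    proof (cases "s \<in> T0")
      case True
      have "b s = x"
        by (rule sign_change_at_deterministic[OF all_indices[OF i] b sM path_on_T0[OF True]])
      then show ?thesis using path_on_T0[OF True] y by (auto elim!: eventually_mono)
    qed (use sM in \<open>auto intro: marginal_atomless\<close>)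
    show "(\<lambda>k. cell_balance i j (\<sigma> k) y) \<longlonglongrightarrow> cell_balance i j s y"
      unfolding weighted_process.balance_def[OF wp]
    proof (rule integral_dominated_convergence)
      show "integrable P (cell_weight i)" by (rule weighted_process.W_integrable[OF wp])
      show "AE \<omega> in P. norm (cell_weight i \<omega> * signed_powr (p - 1) (y - X (\<sigma> k) \<omega> $ j)) \<le> cell_weight i \<omega>" for k
        using cell_weight_nonneg by (intro AE_I2) (simp add: p_eq_1 signed_powr_zero_exponent abs_mult sgn_if)
      show "AE \<omega> in P. (\<lambda>k. cell_weight i \<omega> * signed_powr (p - 1) (y - X (\<sigma> k) \<omega> $ j))
        \<longlonglongrightarrow> cell_weight i \<omega> * signed_powr (p - 1) (y - X s \<omega> $ j)"
        using ne AE_space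
      proof eventually_elim
        case (elim \<omega>)
        have "(\<lambda>k. X (\<sigma> k) \<omega>) \<longlonglongrightarrow> X s \<omega>"
          by (rule continuous_functions_sequentially[OF paths[OF elim(2)] lim])
        then show ?case
          unfolding p_eq_1 using elim(1) by (simp add: signed_powr_zero_exponent) (intro tendsto_intros; auto)
      qed
    qed (use weighted_process.balance_integrable[OF wp] sM \<sigma>M in \<open>auto intro: borel_measurable_integrable\<close>)
  qed (use b sM \<sigma>M in auto)
  then show "(\<lambda>k. b (\<sigma> k)) \<longlonglongrightarrow> b s" by (rule vec_tendstoI)
qed

lemma continuous_version:
  assumes i: "i \<in> {1..n}"
  shows "\<exists>b. Lp_version M p (a i) b \<and> b \<in> continuous_functions m \<and> (\<forall>t\<in>T0. b t = x)"
proof -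
  note i' = all_indices[OF i]
  obtain b where b: "\<And>t j. t \<in> space M \<Longrightarrow> changes_sign_at (cell_balance i j t) (b t $ j)"
    using sign_change_vector[OF i' continuous_sign_change[OF i]] by blast
  have "b t = x" if "t \<in> T0" for t
    using sign_change_at_deterministic[OF i' b _ path_on_T0[OF that]] that T0_sub by blast
  then show ?thesis
    using sign_change_version[OF i' b] sign_change_continuous_function[OF i b] by blast
qed

end

theorem theorem5:
  fixes M :: "'t measure" and P :: "'w measure"
    and X :: "'t \<Rightarrow> 'w \<Rightarrow> real ^ 'd"
    and a :: "nat \<Rightarrow> 't \<Rightarrow> real ^ 'd"
    and n :: nat and p r :: real
  assumes "finite_measure M" and "prob_space P"
    and "n \<ge> 1" and "1 \<le> p" and "p \<le> r"
    and "Lp_separable M p TYPE('d)"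
    and "bimeasurable P M X"
    and "finite_path_moment P M p r X"
    and "\<forall>t\<in>space M. Lq_random_vector P (r - 1) (X t)"
    and "stationary_quantizer P M p r X n a"
  shows
    "(\<forall>m x T0.
        compact_metric_borel m M \<longrightarrow> continuous_measure M \<longrightarrow> p = 1 \<longrightarrow>
        (\<forall>\<omega>\<in>space P. (\<lambda>t. X t \<omega>) \<in> continuous_functions m) \<longrightarrow>
        closedin (mtopology_of m) T0 \<longrightarrow> emeasure M T0 = 0 \<longrightarrow>
        path_support P m X = {f \<in> continuous_functions m. \<forall>t\<in>T0. f t = x} \<longrightarrow>
        (\<forall>t\<in>space M - T0. \<forall>j. continuous_measure (distr P borel (\<lambda>\<omega>. X t \<omega> $ j))) \<longrightarrow>
        (\<forall>i\<in>{1..n}. \<exists>b. Lp_version M p (a i) b \<and> b \<in> continuous_functions m \<and>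
           (\<forall>t\<in>T0. b t = x)))
     \<and>
     (1 < p \<longrightarrow>
        (\<forall>i\<in>index_set P M p r X n a. \<exists>b. Lp_version M p (a i) b \<and>
           semimetric_continuous_on (space M) (intrinsic_semimetric P X (r - 1)) b) \<and>
        (\<forall>x T0. T0 \<subseteq> space M \<longrightarrow> (\<forall>t\<in>T0. AE \<omega> in P. X t \<omega> = x) \<longrightarrow>
           (\<forall>i\<in>index_set P M p r X n a. \<exists>b. Lp_version M p (a i) b \<and>
              semimetric_continuous_on (space M) (intrinsic_semimetric P X (r - 1)) b \<and>
              (\<forall>t\<in>T0. b t = x))))
     \<and>
     (p = 2 \<longrightarrow>
        (\<forall>i\<in>index_set P M p r X n a. \<exists>b. Lp_version M p (a i) b \<and>
           semimetric_lipschitz_on (space M) (intrinsic_semimetric P X (r - 1)) b))"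
proof -
  interpret P: prob_space P by fact
  interpret M: finite_measure M by fact
  interpret stationary_process P M X a n p r
    by unfold_locales (use assms in auto)
  have continuous: "\<exists>b. Lp_version M p (a i) b \<and> b \<in> continuous_functions m \<and> (\<forall>t\<in>T0. b t = x)"
    if "compact_metric_borel m M" "continuous_measure M" "p = 1"
      "\<forall>\<omega>\<in>space P. (\<lambda>t. X t \<omega>) \<in> continuous_functions m"
      "closedin (mtopology_of m) T0" "emeasure M T0 = 0"
      "path_support P m X = {f \<in> continuous_functions m. \<forall>t\<in>T0. f t = x}"
      "\<forall>t\<in>space M - T0. \<forall>j. continuous_measure (distr P borel (\<lambda>\<omega>. X t \<omega> $ j))"
      "i \<in> {1..n}" for m x T0 i
  \<comment> \<open>If \<open>M\<close> vanishes, all functions are versions of each other.\<close>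
  proof (cases "emeasure M (space M) = 0")
    case True
    then have "AE t in M. False" by (simp add: AE_iff_null null_sets_def)
    then have "AE t in M. x = a i t" by eventually_elim simp
    moreover have "(\<lambda>_. x) \<in> Lp_space M p" by (simp add: Lp_space_iff[OF p_pos])
    ultimately show ?thesis
      by (intro exI[of _ "\<lambda>_. x"]) (simp add: Lp_version_def continuous_functions_def)
  next
    case False
    interpret continuous_process P M X a n p r m x T0
      by unfold_locales (use that False in auto)
    show ?thesis by (rule continuous_version) fact
  qed
  have convex: "\<exists>b. Lp_version M p (a i) b \<and>
      semimetric_continuous_on (space M) (intrinsic_semimetric P X (r - 1)) b \<and>
      (\<forall>T0 x. T0 \<subseteq> space M \<longrightarrow> (\<forall>t\<in>T0. AE \<omega> in P. X t \<omega> = x) \<longrightarrow> (\<forall>t\<in>T0. b t = x)) \<and>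
      (p = 2 \<longrightarrow> semimetric_lipschitz_on (space M) (intrinsic_semimetric P X (r - 1)) b)"
    if p: "p > 1" and i: "i \<in> index_set P M p r X n a" for i
  proof -
    obtain b where b: "\<And>t j. t \<in> space M \<Longrightarrow> changes_sign_at (cell_balance i j t) (b t $ j)"
      using strictly_convex_sign_change[OF p i] by blast
    show ?thesis
    proof (intro exI conjI allI impI ballI)
      show "Lp_version M p (a i) b" by (rule sign_change_version[OF i b])
      show "semimetric_continuous_on (space M) (intrinsic_semimetric P X (r - 1)) b"
        by (rule sign_change_semimetric_continuous[OF p i b])
      show "semimetric_lipschitz_on (space M) (intrinsic_semimetric P X (r - 1)) b" if "p = 2"
        by (rule sign_change_semimetric_lipschitz[OF that i b])
      show "b t = x" if "T0 \<subseteq> space M" "\<forall>t\<in>T0. AE \<omega> in P. X t \<omega> = x" "t \<in> T0" for T0 x t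
        using that by (intro sign_change_at_deterministic[OF i b]) auto
    qed
  qed
  show ?thesis
  proof (intro conjI)
    show "\<forall>m x T0.
        compact_metric_borel m M \<longrightarrow> continuous_measure M \<longrightarrow> p = 1 \<longrightarrow>
        (\<forall>\<omega>\<in>space P. (\<lambda>t. X t \<omega>) \<in> continuous_functions m) \<longrightarrow>
        closedin (mtopology_of m) T0 \<longrightarrow> emeasure M T0 = 0 \<longrightarrow>
        path_support P m X = {f \<in> continuous_functions m. \<forall>t\<in>T0. f t = x} \<longrightarrow>
        (\<forall>t\<in>space M - T0. \<forall>j. continuous_measure (distr P borel (\<lambda>\<omega>. X t \<omega> $ j))) \<longrightarrow>
        (\<forall>i\<in>{1..n}. \<exists>b. Lp_version M p (a i) b \<and> b \<in> continuous_functions m \<and> (\<forall>t\<in>T0. b t = x))"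
      using continuous by (intro allI impI ballI)
  next
    show "1 < p \<longrightarrow>
        (\<forall>i\<in>index_set P M p r X n a. \<exists>b. Lp_version M p (a i) b \<and>
           semimetric_continuous_on (space M) (intrinsic_semimetric P X (r - 1)) b) \<and>
        (\<forall>x T0. T0 \<subseteq> space M \<longrightarrow> (\<forall>t\<in>T0. AE \<omega> in P. X t \<omega> = x) \<longrightarrow>
           (\<forall>i\<in>index_set P M p r X n a. \<exists>b. Lp_version M p (a i) b \<and>
              semimetric_continuous_on (space M) (intrinsic_semimetric P X (r - 1)) b \<and>
              (\<forall>t\<in>T0. b t = x)))"
      using convex by meson
  next
    show "p = 2 \<longrightarrow>
        (\<forall>i\<in>index_set P M p r X n a. \<exists>b. Lp_version M p (a i) b \<and>
           semimetric_lipschitz_on (space M) (intrinsic_semimetric P X (r - 1)) b)"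
      using convex by force
  qed
qed

end
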